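(* Let $d\ge2$, $\beta\in[0,1]$, $\kappa>0$, and let $d_1$ be a pseudo-metric on $\mathbb{R}$. Then $\mathrm{PSSFG}(\cdot,\cdot;\beta,\kappa)$ is a pseudo-metric on $\mathcal{P}(\mathbb{R}^d)$: it is non-negative, symmetric, and there is a constant $C'>0$ with $\mathrm{PSSFG}(\mu,\xi;\beta,\kappa)\le C'[\mathrm{PSSFG}(\mu,\nu;\beta,\kappa)+\mathrm{PSSFG}(\nu,\xi;\beta,\kappa)]$ for all $\mu,\nu,\xi\in\mathcal{P}(\mathbb{R}^d)$.
   Context: $\mathcal{P}(\mathbb{R}^d)$: probability measures on $\mathbb{R}^d$ with finite moments. A pseudo-metric $d_1$ on $\mathbb{R}$ is non-negative, symmetric, with $d_1(x,z)\le C[d_1(x,y)+d_1(y,z)]$ for a universal $C>0$. $\mathbb{S}^{d-1}$ is the unit sphere; $\theta\sharp\mu$ is the pushforward under $x\mapsto\theta^\top x$. For probability measures $\rho,\eta$ on $\mathbb{R}$, $D_{fgw}(\rho,\eta;\beta,d_1)=\min_{\pi\in\Pi(\rho,\eta)}\Big\{(1-\beta)\int d_1(s,t)d\pi+\beta\iint[d_1(s,s')-d_1(t,t')]^2d\pi(s,t)d\pi(s',t')\Big\}$. The power spherical distribution $\mathrm{PS}(\cdot\mid\epsilon,\kappa)$ ($\epsilon\in\mathbb{S}^{d-1}$, $\kappa\ge0$) has density $C(\kappa,d)(1+\epsilon^\top x)^\kappa$ w.r.t. surface measure on $\mathbb{S}^{d-1}$, with $C(\kappa,d)=\big\{2^{d-1+\kappa}\pi^{(d-1)/2}\Gamma(\tfrac{d-1}{2}+\kappa)/\Gamma(d-1+\kappa)\big\}^{-1}$.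 $\mathrm{PSSFG}(\mu,\nu;\beta,\kappa)=\max_{\epsilon\in\mathbb{S}^{d-1}}\mathbb{E}_{\theta\sim\mathrm{PS}(\cdot\mid\epsilon,\kappa)}[D_{fgw}(\theta\sharp\mu,\theta\sharp\nu;\beta,d_1)]$. *)

theory Defs
  imports "HOL-Analysis.Analysis" "HOL-Probability.Probability"
begin

definition pseudo_metric_real :: "(real \<Rightarrow> real \<Rightarrow> real) \<Rightarrow> bool" where
  "pseudo_metric_real d1 \<longleftrightarrow>
     (\<forall>x y. 0 \<le> d1 x y) \<and> (\<forall>x y. d1 x y = d1 y x) \<and>
     (\<exists>C>0. \<forall>x y z. d1 x z \<le> C * (d1 x y + d1 y z))"

definition prob_fin_moments :: "(real ^ 'n) measure set" where
  "prob_fin_moments = {\<mu>. sets \<mu> = sets borel \<and> prob_space \<mu> \<and>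
                           (\<forall>k::nat. integrable \<mu> (\<lambda>x. norm x ^ k))}"

definition proj_push :: "real ^ 'n \<Rightarrow> (real ^ 'n) measure \<Rightarrow> real measure" where
  "proj_push \<theta> \<mu> = distr \<mu> borel (\<lambda>x. \<theta> \<bullet> x)"

definition couplings :: "real measure \<Rightarrow> real measure \<Rightarrow> (real \<times> real) measure set" where
  "couplings \<rho> \<eta> = {\<pi>. sets \<pi> = sets (borel :: (real \<times> real) measure) \<and> prob_space \<pi> \<and>
                         distr \<pi> borel fst = \<rho> \<and> distr \<pi> borel snd = \<eta>}"

definition D_fgw :: "real measure \<Rightarrow> real measure \<Rightarrow> real \<Rightarrow> (real \<Rightarrow> real \<Rightarrow> real) \<Rightarrow> ennreal" where
  "D_fgw \<rho> \<eta> \<beta> d1 =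
     (INF \<pi>\<in>couplings \<rho> \<eta>.
        ennreal (1 - \<beta>) * (\<integral>\<^sup>+ p. ennreal (d1 (fst p) (snd p)) \<partial>\<pi>)
      + ennreal \<beta> * (\<integral>\<^sup>+ p. (\<integral>\<^sup>+ q. ennreal ((d1 (fst p) (fst q) - d1 (snd p) (snd q))\<^sup>2) \<partial>\<pi>) \<partial>\<pi>))"

(* Surface measure on the unit sphere S^{d-1}, given by the cone construction:
  \<sigma>(A) = d \<cdot> Leb{ r x | 0 \<le> r \<le> 1, x \<in> A \<inter> S^{d-1} }. *)
definition sphere_surface :: "(real ^ 'n) measure" where
  "sphere_surface = measure_of UNIV (sets borel)
     (\<lambda>A. ennreal (real CARD('n)) *
          emeasure lborel {r *\<^sub>R x | r x. r \<in> {0..1} \<and> x \<in> A \<inter> sphere 0 1})"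

definition PS_const :: "real \<Rightarrow> nat \<Rightarrow> real" where
  "PS_const \<kappa> d = inverse (2 powr (real d - 1 + \<kappa>) * pi powr ((real d - 1) / 2) *
                     Gamma ((real d - 1) / 2 + \<kappa>) / Gamma (real d - 1 + \<kappa>))"

definition power_spherical :: "real ^ 'n \<Rightarrow> real \<Rightarrow> (real ^ 'n) measure" where
  "power_spherical \<epsilon> \<kappa> =
     density sphere_surface
       (\<lambda>x. ennreal (PS_const \<kappa> CARD('n) * (1 + \<epsilon> \<bullet> x) powr \<kappa>))"

(* Power spherical sliced fused Gromov-Wasserstein (max realised as a supremum). *)
definition PSSFG :: "(real ^ 'n) measure \<Rightarrow> (real ^ 'n) measure \<Rightarrow> real \<Rightarrow> real
                      \<Rightarrow> (real \<Rightarrow> real \<Rightarrow> real) \<Rightarrow> ennreal" where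
  "PSSFG \<mu> \<nu> \<beta> \<kappa> d1 =
     (SUP \<epsilon>\<in>sphere 0 1.
        \<integral>\<^sup>+ \<theta>. D_fgw (proj_push \<theta> \<mu>) (proj_push \<theta> \<nu>) \<beta> d1 \<partial>(power_spherical \<epsilon> \<kappa>))"

end

theory Submission
  imports Defs
begin

text \<open>For fixed marginals the triangle inequality of \<open>D_fgw\<close> follows from gluing two couplings along
  their common marginal; the linear term uses the quasi-triangle inequality of \<open>d1\<close>, the quadratic
  one \<open>(a - c)\<^sup>2 \<le> 2 * ((a - b)\<^sup>2 + (b - c)\<^sup>2)\<close>.

  Integrating it over the direction \<open>\<theta>\<close> needs additivity of the integral, which fails for
  non-measurable integrands, and \<open>d1\<close> is only assumed to be Borel. Every coupling of \<open>\<theta>\<sharp>\<mu>\<close> with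
  another law is the law of \<open>(\<theta> \<bullet> x, h (x, u))\<close> for a measurable \<open>h\<close>, where \<open>x\<close> has law \<open>\<mu>\<close> and
  \<open>u\<close> is uniform and independent of \<open>x\<close>. Measurable functions \<open>h\<close> are coded modulo null sets by
  sequences of integers, so that \<open>{\<theta>. D_fgw < c}\<close> is the projection of a measurable set along
  \<open>nat \<Rightarrow> nat\<close>. Such a projection is a Suslin set and hence lies in the completion of the surface
  measure.\<close>

section \<open>Suslin sets and measurable projection\<close>

text \<open>\<open>nn_integral\<close> is a supremum over simple functions below the integrand, so
  without measurability it is only superadditive, which is the wrong direction for splitting the
  right-hand side of the integrated triangle inequality. With \<open>d1\<close> merely Borel,
  \<open>D_fgw\<close> need not be semicontinuous in the marginals and optimal couplings need not
  exist, so neither continuity in \<theta> nor a selection of minimisers is available. What remains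
  is that \<open>D_fgw < c\<close> is an existential statement over couplings. The set of couplings
  moves with \<theta>; realising all of them on the fixed space of pairs (x, u) moves \<theta> into
  the integrands, where joint measurability is a matter of Fubini. The exceptional null set is one
  of the surface measure and therefore serves every \<epsilon> at once. The final constant is max C
  2: C for the linear term, 2 for the quadratic one.\<close>

definition locally_const :: "((nat \<Rightarrow> nat) \<Rightarrow> 'b) \<Rightarrow> bool" where
  "locally_const f \<longleftrightarrow> (\<forall>\<alpha>. \<exists>m. \<forall>\<alpha>'. (\<forall>i<m. \<alpha>' i = \<alpha> i) \<longrightarrow> f \<alpha>' = f \<alpha>)"

text \<open>Suslin schemes are usually indexed by finite sequences. Here they are maps on Baire
  space, continuous into the discrete space of sets. Each \<open>R k\<close> may look at any finite
  number of coordinates, so recoding the index sequence again gives a scheme, with no bookkeeping of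
  lengths.\<close>

definition suslin :: "'a set set \<Rightarrow> 'a set set" where
  "suslin G = {(\<Union>\<alpha>. \<Inter>k. R k \<alpha>) | R :: nat \<Rightarrow> (nat \<Rightarrow> nat) \<Rightarrow> 'a set.
     (\<forall>k. locally_const (R k)) \<and> (\<forall>k \<alpha>. R k \<alpha> \<in> G)}"

lemma locally_const_const: "locally_const (\<lambda>_. c)"
  by (auto simp: locally_const_def)

lemma locally_const_coord: "locally_const (\<lambda>\<alpha>. \<alpha> i)"
  unfolding locally_const_def by (meson lessI)

lemma locally_const_compose:
  assumes f: "locally_const f" and \<phi>: "\<And>n. locally_const (\<lambda>\<alpha>. \<phi> \<alpha> n)"
  shows "locally_const (\<lambda>\<alpha>. f (\<phi> \<alpha>))"
  unfolding locally_const_def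
proof
  fix \<alpha>
  from f obtain m where m: "\<And>\<beta>. (\<forall>i<m. \<beta> i = \<phi> \<alpha> i) \<Longrightarrow> f \<beta> = f (\<phi> \<alpha>)"
    unfolding locally_const_def by blast
  have "\<forall>n. \<exists>k. \<forall>\<alpha>'. (\<forall>i<k. \<alpha>' i = \<alpha> i) \<longrightarrow> \<phi> \<alpha>' n = \<phi> \<alpha> n"
    using \<phi> unfolding locally_const_def by blast
  then obtain K where K: "\<And>n \<alpha>'. (\<forall>i<K n. \<alpha>' i = \<alpha> i) \<Longrightarrow> \<phi> \<alpha>' n = \<phi> \<alpha> n"
    by metis
  have K_le: "K n \<le> (\<Sum>n<m. K n)" if "n < m" for n
    using that by (intro member_le_sum) auto
  \<comment> \<open>The sum dominates every \<open>K n\<close> with n < m and, unlike a maximum,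
    also makes sense for m = 0.\<close>
  have "f (\<phi> \<alpha>') = f (\<phi> \<alpha>)" if "\<forall>i<(\<Sum>n<m. K n). \<alpha>' i = \<alpha> i" for \<alpha>'
    using that K_le by (intro m allI impI K) (meson order_less_le_trans)
  then show "\<exists>m. \<forall>\<alpha>'. (\<forall>i<m. \<alpha>' i = \<alpha> i) \<longrightarrow> f (\<phi> \<alpha>') = f (\<phi> \<alpha>)"
    by blast
qed

lemma suslinI:
  fixes R :: "nat \<Rightarrow> (nat \<Rightarrow> nat) \<Rightarrow> 'a set"
  assumes "\<And>k. locally_const (R k)" "\<And>k \<alpha>. R k \<alpha> \<in> G" "B = (\<Union>\<alpha>. \<Inter>k. R k \<alpha>)"
  shows "B \<in> suslin G"
  unfolding suslin_def mem_Collect_eq by (rule exI[of _ R]) (use assms in simp)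

lemma suslinE:
  assumes "B \<in> suslin G"
  obtains R :: "nat \<Rightarrow> (nat \<Rightarrow> nat) \<Rightarrow> 'a set"
    where "\<And>k. locally_const (R k)" "\<And>k \<alpha>. R k \<alpha> \<in> G" "B = (\<Union>\<alpha>. \<Inter>k. R k \<alpha>)"
  using assms unfolding suslin_def mem_Collect_eq by (elim exE conjE) blast

lemma suslin_basic: "B \<in> G \<Longrightarrow> B \<in> suslin G"
  by (rule suslinI[where R="\<lambda>_ _. B"]) (auto simp: locally_const_const)

lemma suslin_UN:
  fixes B :: "nat \<Rightarrow> 'a set"
  assumes "\<And>i. B i \<in> suslin G"
  shows "(\<Union>i. B i) \<in> suslin G"
proof -
  have "\<exists>R :: nat \<Rightarrow> (nat \<Rightarrow> nat) \<Rightarrow> 'a set. (\<forall>k. locally_const (R k)) \<and> (\<forall>k \<alpha>. R k \<alpha> \<in> G) \<and> B i = (\<Union>\<alpha>. \<Inter>k. R k \<alpha>)" for i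
    by (rule suslinE[OF assms[of i]]) blast
  then obtain R :: "nat \<Rightarrow> nat \<Rightarrow> (nat \<Rightarrow> nat) \<Rightarrow> 'a set"
    where R: "\<And>i k. locally_const (R i k)" "\<And>i k \<alpha>. R i k \<alpha> \<in> G"
    "\<And>i. B i = (\<Union>\<alpha>. \<Inter>k. R i k \<alpha>)"
    by metis
  \<comment> \<open>Coordinate 0 selects the set and the shifted tail is the witness for membership
    in it.\<close>
  show ?thesis
  proof (rule suslinI[where R="\<lambda>k \<alpha>. R (\<alpha> 0) k (\<lambda>n. \<alpha> (Suc n))"])
    show "locally_const (\<lambda>\<alpha>. R (\<alpha> 0) k (\<lambda>n. \<alpha> (Suc n)))" for k
      unfolding locally_const_def
    proof
      fix \<alpha> :: "nat \<Rightarrow> nat"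
      \<comment> \<open>The selector is frozen so that composition applies to the tail alone;
        agreement below \<open>Suc m\<close> then fixes the selector as well.\<close>
      have "locally_const (\<lambda>\<beta>. R (\<alpha> 0) k (\<lambda>n. \<beta> (Suc n)))"
        by (intro locally_const_compose[OF R(1)] locally_const_coord)
      then obtain m where m: "\<And>\<beta>. (\<forall>i<m. \<beta> i = \<alpha> i) \<Longrightarrow>
          R (\<alpha> 0) k (\<lambda>n. \<beta> (Suc n)) = R (\<alpha> 0) k (\<lambda>n. \<alpha> (Suc n))"
        unfolding locally_const_def by metis
      show "\<exists>m. \<forall>\<alpha>'. (\<forall>i<m. \<alpha>' i = \<alpha> i) \<longrightarrow>
          R (\<alpha>' 0) k (\<lambda>n. \<alpha>' (Suc n)) = R (\<alpha> 0) k (\<lambda>n. \<alpha> (Suc n))"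
        using m by (intro exI[of _ "Suc m"]) (metis less_Suc_eq zero_less_Suc)
    qed
    show "(\<Union>i. B i) = (\<Union>\<alpha>. \<Inter>k. R (\<alpha> 0) k (\<lambda>n. \<alpha> (Suc n)))"
    proof (intro equalityI subsetI)
      fix x assume "x \<in> (\<Union>i. B i)"
      then obtain i \<alpha> where "x \<in> (\<Inter>k. R i k \<alpha>)" using R(3) by blast
      then have "x \<in> (\<Inter>k. R ((case_nat i \<alpha>) 0) k (\<lambda>n. (case_nat i \<alpha>) (Suc n)))" by simp
      then show "x \<in> (\<Union>\<alpha>. \<Inter>k. R (\<alpha> 0) k (\<lambda>n. \<alpha> (Suc n)))" by blast
    qed (use R(3) in blast)
  qed (rule R(2))
qed

lemma suslin_INT:
  fixes B :: "nat \<Rightarrow> 'a set"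
  assumes "\<And>i. B i \<in> suslin G"
  shows "(\<Inter>i. B i) \<in> suslin G"
proof -
  have "\<exists>R :: nat \<Rightarrow> (nat \<Rightarrow> nat) \<Rightarrow> 'a set. (\<forall>k. locally_const (R k)) \<and> (\<forall>k \<alpha>. R k \<alpha> \<in> G) \<and> B i = (\<Union>\<alpha>. \<Inter>k. R k \<alpha>)" for i
    by (rule suslinE[OF assms[of i]]) blast
  then obtain R :: "nat \<Rightarrow> nat \<Rightarrow> (nat \<Rightarrow> nat) \<Rightarrow> 'a set"
    where R: "\<And>i k. locally_const (R i k)" "\<And>i k \<alpha>. R i k \<alpha> \<in> G"
    "\<And>i. B i = (\<Union>\<alpha>. \<Inter>k. R i k \<alpha>)"
    by metis
  \<comment> \<open>One sequence stores a whole array: row i is the witness for \<open>B i\<close>,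
    and p stands for the pair (i, k).\<close>
  define Q where "Q p \<alpha> = R (fst (prod_decode p)) (snd (prod_decode p))
      (\<lambda>n. \<alpha> (prod_encode (fst (prod_decode p), n)))" for p \<alpha>
  show ?thesis
  proof (rule suslinI[where R=Q])
    show "locally_const (Q p)" for p
      unfolding Q_def by (intro locally_const_compose[OF R(1)] locally_const_coord)
    show "(\<Inter>i. B i) = (\<Union>\<alpha>. \<Inter>p. Q p \<alpha>)"
    proof (intro equalityI subsetI)
      fix x assume "x \<in> (\<Inter>i. B i)"
      then have "\<forall>i. \<exists>\<alpha>. x \<in> (\<Inter>k. R i k \<alpha>)" using R(3) by blast
      then obtain a where a: "\<And>i k. x \<in> R i k (a i)" by (metis INT_D UNIV_I)
      have "x \<in> (\<Inter>p. Q p (\<lambda>j. a (fst (prod_decode j)) (snd (prod_decode j))))"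
        using a by (simp add: Q_def)
      then show "x \<in> (\<Union>\<alpha>. \<Inter>p. Q p \<alpha>)" by blast
    next
      fix x assume "x \<in> (\<Union>\<alpha>. \<Inter>p. Q p \<alpha>)"
      then obtain \<alpha> where \<alpha>: "\<And>p. x \<in> Q p \<alpha>" by blast
      have "x \<in> R i k (\<lambda>n. \<alpha> (prod_encode (i, n)))" for i k
        using \<alpha>[of "prod_encode (i, k)"] by (simp add: Q_def)
      then show "x \<in> (\<Inter>i. B i)" using R(3) by blast
    qed
  qed (simp add: Q_def R(2))
qed

text \<open>Suslin sets are closed under countable unions and intersections but not under
  complements, so the induction carries each set together with its complement.\<close>

lemma sigma_sets_subset_suslin:
  assumes G: "G \<subseteq> Pow \<Omega>" "{} \<in> G" "\<And>B. B \<in> G \<Longrightarrow> \<Omega> - B \<in> G"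
  shows "sigma_sets \<Omega> G \<subseteq> suslin G"
proof -
  have "B \<in> suslin G \<and> \<Omega> - B \<in> suslin G" if "B \<in> sigma_sets \<Omega> G" for B
    using that
  proof induction
    case Empty
    then show ?case using G(2,3) suslin_basic by blast
  next
    case (Compl a)
    then have "\<Omega> - (\<Omega> - a) = a"
      using sigma_sets_into_sp[OF G(1)] by blast
    with Compl show ?case by simp
  next
    case (Union a)
    have "\<Omega> - (\<Union>i. a i) = (\<Inter>i. \<Omega> - a i)" by blast
    with Union show ?case by (metis suslin_UN suslin_INT)
  qed (use G suslin_basic in blast)
  then show ?thesis by blast
qed

text \<open>Projection adds an existential over y to the one over \<alpha> already present.
  Interleaving both into a single sequence, \<alpha> on even and y on odd places, merges the
  two.\<close>

lemma fst_image_suslin: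
  fixes B :: "('a \<times> (nat \<Rightarrow> nat)) set"
  assumes B: "B \<in> suslin G"
    and G: "\<And>A. A \<in> G \<Longrightarrow> locally_const (\<lambda>y. {x. (x, y) \<in> A})"
      "\<And>A y. A \<in> G \<Longrightarrow> {x. (x, y) \<in> A} \<in> H"
  shows "fst ` B \<in> suslin H"
proof -
  obtain R :: "nat \<Rightarrow> (nat \<Rightarrow> nat) \<Rightarrow> ('a \<times> (nat \<Rightarrow> nat)) set"
    where R: "\<And>k. locally_const (R k)" "\<And>k \<alpha>. R k \<alpha> \<in> G" "B = (\<Union>\<alpha>. \<Inter>k. R k \<alpha>)"
    using B by (rule suslinE) blast
  define ev od :: "(nat \<Rightarrow> nat) \<Rightarrow> nat \<Rightarrow> nat"
    where "ev \<gamma> = (\<lambda>n. \<gamma> (2 * n))" and "od \<gamma> = (\<lambda>n. \<gamma> (2 * n + 1))" for \<gamma>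
  have join: "\<exists>\<gamma>. ev \<gamma> = \<alpha> \<and> od \<gamma> = y" for \<alpha> y
    by (rule exI[of _ "\<lambda>n. if even n then \<alpha> (n div 2) else y (n div 2)"]) (auto simp: ev_def od_def)
  show ?thesis
  proof (rule suslinI[where R="\<lambda>k \<gamma>. {x. (x, od \<gamma>) \<in> R k (ev \<gamma>)}"])
    show "locally_const (\<lambda>\<gamma>. {x. (x, od \<gamma>) \<in> R k (ev \<gamma>)})" for k
      unfolding locally_const_def
    proof
      fix \<gamma>
      have "locally_const (\<lambda>\<gamma>. R k (ev \<gamma>))"
        unfolding ev_def by (intro locally_const_compose[OF R(1)] locally_const_coord)
      then obtain m where m: "\<And>\<gamma>'. (\<forall>i<m. \<gamma>' i = \<gamma> i) \<Longrightarrow> R k (ev \<gamma>') = R k (ev \<gamma>)"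
        unfolding locally_const_def by metis
      have "locally_const (\<lambda>\<gamma>'. {x. (x, od \<gamma>') \<in> R k (ev \<gamma>)})"
        unfolding od_def by (intro locally_const_compose[OF G(1)[OF R(2)]] locally_const_coord)
      then obtain m' where m': "\<And>\<gamma>'. (\<forall>i<m'. \<gamma>' i = \<gamma> i) \<Longrightarrow>
          {x. (x, od \<gamma>') \<in> R k (ev \<gamma>)} = {x. (x, od \<gamma>) \<in> R k (ev \<gamma>)}"
        unfolding locally_const_def by metis
      show "\<exists>m. \<forall>\<gamma>'. (\<forall>i<m. \<gamma>' i = \<gamma> i) \<longrightarrow>
          {x. (x, od \<gamma>') \<in> R k (ev \<gamma>')} = {x. (x, od \<gamma>) \<in> R k (ev \<gamma>)}"
      proof (intro exI[of _ "max m m'"] allI impI)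
        fix \<gamma>' assume a: "\<forall>i<max m m'. \<gamma>' i = \<gamma> i"
        have "R k (ev \<gamma>') = R k (ev \<gamma>)" by (rule m) (use a in simp)
        moreover have "{x. (x, od \<gamma>') \<in> R k (ev \<gamma>)} = {x. (x, od \<gamma>) \<in> R k (ev \<gamma>)}"
          by (rule m') (use a in simp)
        ultimately show "{x. (x, od \<gamma>') \<in> R k (ev \<gamma>')} = {x. (x, od \<gamma>) \<in> R k (ev \<gamma>)}"
          by simp
      qed
    qed
    show "fst ` B = (\<Union>\<gamma>. \<Inter>k. {x. (x, od \<gamma>) \<in> R k (ev \<gamma>)})"
    proof (intro equalityI subsetI)
      fix x assume "x \<in> fst ` B"
      then obtain y \<alpha> where "\<forall>k. (x, y) \<in> R k \<alpha>" using R(3) by auto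
      then show "x \<in> (\<Union>\<gamma>. \<Inter>k. {x. (x, od \<gamma>) \<in> R k (ev \<gamma>)})" using join[of \<alpha> y] by blast
    next
      fix x assume "x \<in> (\<Union>\<gamma>. \<Inter>k. {x. (x, od \<gamma>) \<in> R k (ev \<gamma>)})"
      then obtain \<gamma> where "(x, od \<gamma>) \<in> B" using R(3) by blast
      then show "x \<in> fst ` B" by force
    qed
  qed (use G(2) R(2) in blast)
qed

section \<open>Capacitability: Suslin sets and the completion of a finite measure\<close>

lemma koenig_bounded:
  fixes E :: "nat \<Rightarrow> (nat \<Rightarrow> nat) \<Rightarrow> bool"
  assumes local: "\<And>n \<alpha> \<alpha>'. (\<forall>i<n. \<alpha>' i = \<alpha> i) \<Longrightarrow> E n \<alpha> \<Longrightarrow> E n \<alpha>'"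
    and anti: "\<And>m n \<alpha>. m \<le> n \<Longrightarrow> E n \<alpha> \<Longrightarrow> E m \<alpha>"
    and ex: "\<And>n. \<exists>\<alpha>. (\<forall>i<n. \<alpha> i \<le> v i) \<and> E n \<alpha>"
  shows "\<exists>\<alpha>. \<forall>n. E n \<alpha>"
proof -
  \<comment> \<open>Koenig's lemma: a prefix is good if bounded sequences extending it reach every
    level of the tree. Finite branching, given by v, lets a good prefix always be prolonged.\<close>
  define good where "good n \<alpha> \<longleftrightarrow> (\<forall>N. \<exists>\<alpha>'. (\<forall>i<n. \<alpha>' i = \<alpha> i) \<and> (\<forall>i. \<alpha>' i \<le> v i) \<and> E N \<alpha>')" for n \<alpha>
  have base: "good 0 \<alpha>" for \<alpha>
    unfolding good_def
  proof
    fix N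
    obtain \<beta> where \<beta>: "\<forall>i<N. \<beta> i \<le> v i" "E N \<beta>" using ex by blast
    \<comment> \<open>Padding with 0 beyond N secures the bound at all coordinates, which
      \<open>good\<close> demands, while \<open>E N\<close> sees only the first N.\<close>
    show "\<exists>\<alpha>'. (\<forall>i<0. \<alpha>' i = \<alpha> i) \<and> (\<forall>i. \<alpha>' i \<le> v i) \<and> E N \<alpha>'"
      using \<beta> local[of N "\<lambda>i. if i < N then \<beta> i else 0" \<beta>]
      by (intro exI[of _ "\<lambda>i. if i < N then \<beta> i else 0"]) auto
  qed
  have step: "\<exists>j. good (Suc n) (\<alpha>(n := j))" if g: "good n \<alpha>" for n \<alpha>
  proof (rule ccontr)
    assume "\<nexists>j. good (Suc n) (\<alpha>(n := j))"
    then have "\<forall>j. \<exists>N. \<forall>\<alpha>'. (\<forall>i<Suc n. \<alpha>' i = (\<alpha>(n := j)) i) \<and> (\<forall>i. \<alpha>' i \<le> v i) \<longrightarrow> \<not> E N \<alpha>'"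
      unfolding good_def by blast
    then obtain N where N: "\<And>j \<alpha>'. (\<forall>i<Suc n. \<alpha>' i = (\<alpha>(n := j)) i) \<Longrightarrow> (\<forall>i. \<alpha>' i \<le> v i) \<Longrightarrow> \<not> E (N j) \<alpha>'"
      by metis
    \<comment> \<open>The sum exceeds the failure levels of all j up to \<open>v n\<close> at once,
      and \<open>\<alpha>' n\<close> is one of these j.\<close>
    obtain \<alpha>' where \<alpha>': "\<forall>i<n. \<alpha>' i = \<alpha> i" "\<forall>i. \<alpha>' i \<le> v i" "E (\<Sum>j\<le>v n. N j) \<alpha>'"
      using g unfolding good_def by blast
    have "N (\<alpha>' n) \<le> (\<Sum>j\<le>v n. N j)"
      using \<alpha>'(2) by (intro member_le_sum) auto
    then have "E (N (\<alpha>' n)) \<alpha>'" using anti \<alpha>'(3) by blast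
    then show False using N[of \<alpha>' "\<alpha>' n"] \<alpha>' by (auto simp: less_Suc_eq)
  qed
  have "\<exists>f. \<forall>n. good n (f n) \<and> (\<exists>j. f (Suc n) = (f n)(n := j))"
    by (rule dependent_nat_choice) (use base step in blast)+
  then obtain f where f: "\<And>n. good n (f n)" "\<And>n. \<exists>j. f (Suc n) = (f n)(n := j)"
    by blast
  have stable: "f n i = f (Suc i) i" if "i < n" for n i
    using that
  proof (induction n)
    case (Suc n)
    then show ?case
      using f(2)[of n] by (cases "i = n") auto
  qed simp
  \<comment> \<open>Coordinate i is never changed after stage i + 1, so the diagonal sequence agrees
    with \<open>f n\<close> below n.\<close>
  have "E n (\<lambda>i. f (Suc i) i)" for n
  proof -
    obtain \<alpha>' where \<alpha>': "\<forall>i<n. \<alpha>' i = f n i" "E n \<alpha>'"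
      using f(1)[of n] unfolding good_def by blast
    have "\<forall>i<n. f (Suc i) i = \<alpha>' i"
      using \<alpha>'(1) stable[of _ n] by simp
    then show ?thesis by (rule local) (rule \<alpha>'(2))
  qed
  then show ?thesis by blast
qed

text \<open>Choquet's capacitability argument for the outer measure: bounding the coordinates of
  the index sequence one at a time loses no outer measure in the limit, and the resulting set of
  bounded sequences is compact.\<close>

lemma (in finite_measure) suslin_inner_approx:
  assumes A: "A \<in> suslin (sets M)" and c: "c < outer_measure_of M A"
  shows "\<exists>K\<in>sets M. K \<subseteq> A \<and> c \<le> emeasure M K"
proof -
  obtain R :: "nat \<Rightarrow> (nat \<Rightarrow> nat) \<Rightarrow> 'a set"
    where R: "\<And>k. locally_const (R k)" "\<And>k \<alpha>. R k \<alpha> \<in> sets M" "A = (\<Union>\<alpha>. \<Inter>k. R k \<alpha>)"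
    using A by (rule suslinE) blast
  \<comment> \<open>\<open>det n \<alpha>\<close> holds the indices k below n whose
    \<open>R k\<close> is already determined by the first n coordinates. This turns the scheme into
    sets \<open>E n \<alpha>\<close> that depend on a prefix only, are finite intersections and
    decrease in n.\<close>
  define det where "det n \<alpha> = {k. k < n \<and> (\<forall>\<beta> \<gamma>. (\<forall>i<n. \<beta> i = \<alpha> i) \<longrightarrow> (\<forall>i<n. \<gamma> i = \<alpha> i) \<longrightarrow> R k \<beta> = R k \<gamma>)}" for n \<alpha>
  define E where "E n \<alpha> = space M \<inter> (\<Inter>k\<in>det n \<alpha>. R k \<alpha>)" for n \<alpha>
  have det_finite: "finite (det n \<alpha>)" for n \<alpha>
    unfolding det_def by simp
  have E_sets: "E n \<alpha> \<in> sets M" for n \<alpha>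
  proof (cases "det n \<alpha> = {}")
    case False
    then have "(\<Inter>k\<in>det n \<alpha>. R k \<alpha>) \<in> sets M"
      using det_finite R(2) by (intro sets.finite_INT) auto
    then show ?thesis unfolding E_def by auto
  qed (simp add: E_def)
  have det_local: "det n \<alpha>' = det n \<alpha>" if "\<forall>i<n. \<alpha>' i = \<alpha> i" for n \<alpha> \<alpha>'
  proof -
    have "(\<forall>i<n. \<beta> i = \<alpha>' i) \<longleftrightarrow> (\<forall>i<n. \<beta> i = \<alpha> i)" for \<beta>
      using that by auto
    then show ?thesis unfolding det_def by simp
  qed
  have E_local: "E n \<alpha>' = E n \<alpha>" if "\<forall>i<n. \<alpha>' i = \<alpha> i" for n \<alpha> \<alpha>'
  proof -
    have "R k \<alpha>' = R k \<alpha>" if "k \<in> det n \<alpha>" for k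
      using that \<open>\<forall>i<n. \<alpha>' i = \<alpha> i\<close> unfolding det_def by blast
    then show ?thesis
      unfolding E_def det_local[OF that] by auto
  qed
  have det_mono: "det m \<alpha> \<subseteq> det n \<alpha>" if "m \<le> n" for m n \<alpha>
  proof
    fix k assume k: "k \<in> det m \<alpha>"
    have "R k \<beta> = R k \<gamma>" if "\<forall>i<n. \<beta> i = \<alpha> i" "\<forall>i<n. \<gamma> i = \<alpha> i" for \<beta> \<gamma>
    proof -
      have "\<forall>i<m. \<beta> i = \<alpha> i" "\<forall>i<m. \<gamma> i = \<alpha> i"
        using that \<open>m \<le> n\<close> by auto
      then show ?thesis using k unfolding det_def by blast
    qed
    then show "k \<in> det n \<alpha>" using k that unfolding det_def by auto
  qed
  then have E_anti: "E n \<alpha> \<subseteq> E m \<alpha>" if "m \<le> n" for m n \<alpha>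
    using that unfolding E_def by blast
  have R_space: "R k \<alpha> \<subseteq> space M" for k \<alpha>
    using R(2) sets.sets_into_space by blast
  have E_INT: "(\<Inter>n. E n \<alpha>) = (\<Inter>k. R k \<alpha>)" for \<alpha>
  proof (intro equalityI subsetI)
    fix x assume x: "x \<in> (\<Inter>n. E n \<alpha>)"
    have "x \<in> R k \<alpha>" for k
    proof -
      obtain m where "\<And>\<alpha>'. (\<forall>i<m. \<alpha>' i = \<alpha> i) \<Longrightarrow> R k \<alpha>' = R k \<alpha>"
        using R(1)[of k] unfolding locally_const_def by blast
      note m = this
      \<comment> \<open>The prefix must have length m to determine \<open>R k\<close> and length
        \<open>Suc k\<close> to meet the side condition k < n in \<open>det\<close>.\<close>
      have *: "R k \<beta> = R k \<alpha>" if "\<forall>i<max m (Suc k). \<beta> i = \<alpha> i" for \<beta>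
        by (rule m) (use that in simp)
      have "k \<in> det (max m (Suc k)) \<alpha>"
        unfolding det_def mem_Collect_eq
        by (intro conjI allI impI, simp, subst (1 2) *) simp_all
      then show ?thesis using x unfolding E_def by blast
    qed
    then show "x \<in> (\<Inter>k. R k \<alpha>)" by blast
  qed (use R_space in \<open>auto simp: E_def\<close>)
  define S where "S n v = (\<Union>\<alpha>\<in>{\<alpha>. \<forall>i<n. \<alpha> i \<le> v i}. \<Inter>k. R k \<alpha>)" for n and v :: "nat \<Rightarrow> nat"
  have S_space: "S n v \<subseteq> space M" for n v
    unfolding S_def using R_space by blast
  \<comment> \<open>Bounding coordinate n by j gives sets increasing to \<open>S n v\<close>, and
    outer measure is continuous along increasing unions even of non-measurable sets.\<close>
  have step: "\<exists>j. c < outer_measure_of M (S (Suc n) (v(n := j)))"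
    if "c < outer_measure_of M (S n v)" for n v
  proof -
    have "S n v = (\<Union>j. S (Suc n) (v(n := j)))"
    proof (intro equalityI subsetI)
      fix x assume "x \<in> S n v"
      then obtain \<alpha> where "\<forall>i<n. \<alpha> i \<le> v i" "x \<in> (\<Inter>k. R k \<alpha>)" unfolding S_def by blast
      then have "x \<in> S (Suc n) (v(n := \<alpha> n))" unfolding S_def by (auto simp: less_Suc_eq)
      then show "x \<in> (\<Union>j. S (Suc n) (v(n := j)))" by blast
    next
      fix x assume "x \<in> (\<Union>j. S (Suc n) (v(n := j)))"
      then obtain j \<alpha> where \<alpha>: "\<forall>i<Suc n. \<alpha> i \<le> (v(n := j)) i" "x \<in> (\<Inter>k. R k \<alpha>)"
        unfolding S_def by blast
      have "\<alpha> i \<le> v i" if "i < n" for i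
        using \<alpha>(1)[rule_format, of i] that by (simp split: if_splits)
      with \<alpha>(2) show "x \<in> S n v" unfolding S_def by blast
    qed
    moreover have "incseq (\<lambda>j. S (Suc n) (v(n := j)))"
    proof (rule incseq_SucI)
      fix j
      have "\<alpha> i \<le> (v(n := Suc j)) i" if "\<alpha> i \<le> (v(n := j)) i" for \<alpha> :: "nat \<Rightarrow> nat" and i
        using that by (cases "i = n") auto
      then show "S (Suc n) (v(n := j)) \<subseteq> S (Suc n) (v(n := Suc j))"
        unfolding S_def by blast
    qed
    ultimately have "outer_measure_of M (S n v) = (SUP j. outer_measure_of M (S (Suc n) (v(n := j))))"
      using SUP_outer_measure_of_incseq[of "\<lambda>j. S (Suc n) (v(n := j))" M] S_space by simp
    then show ?thesis using that by (simp add: less_SUP_iff)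
  qed
  have "S 0 v = A" for v
    unfolding S_def R(3) by simp
  then have "\<exists>f. \<forall>n. c < outer_measure_of M (S n (f n)) \<and> (\<exists>j. f (Suc n) = (f n)(n := j))"
    by (intro dependent_nat_choice) (use c in simp, use step in blast)
  then obtain f where f: "\<And>n. c < outer_measure_of M (S n (f n))" "\<And>n. \<exists>j. f (Suc n) = (f n)(n := j)"
    by blast
  define v where "v i = f (Suc i) i" for i
  have stable: "f n i = v i" if "i < n" for n i
    using that
  proof (induction n)
    case (Suc n)
    then show ?case
      using f(2)[of n] by (cases "i = n") (auto simp: v_def)
  qed simp
  have "S n (f n) = S n v" for n
    unfolding S_def by (rule arg_cong[where f="\<lambda>X. \<Union>\<alpha>\<in>X. \<Inter>k. R k \<alpha>"]) (use stable in auto)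
  with f(1) have big: "c < outer_measure_of M (S n v)" for n by simp
  define K where "K n = (\<Union>\<alpha>\<in>{\<alpha>. \<forall>i<n. \<alpha> i \<le> v i}. E n \<alpha>)" for n
  have K_sets: "K n \<in> sets M" for n
  proof -
    \<comment> \<open>The union defining \<open>K n\<close> is uncountable, but \<open>E n\<close>
      sees only the first n coordinates. Setting the others to 0 leaves finitely many
      sequences.\<close>
    define T where "T = {\<alpha>. \<forall>i. (i < n \<longrightarrow> \<alpha> i \<le> v i) \<and> (\<not> i < n \<longrightarrow> \<alpha> i = 0)}"
    have "T \<subseteq> {\<alpha>. \<forall>i. (i \<in> {..<n} \<longrightarrow> \<alpha> i \<in> {..Max (v ` {..<n})}) \<and> (i \<notin> {..<n} \<longrightarrow> \<alpha> i = 0)}"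
      unfolding T_def by (auto intro: order_trans[OF _ Max_ge])
    then have "finite T"
      by (rule finite_subset) (rule finite_set_of_finite_funs; simp)
    moreover have "K n = (\<Union>\<alpha>\<in>T. E n \<alpha>)"
    proof (intro equalityI subsetI)
      fix x assume "x \<in> K n"
      then obtain \<alpha> where \<alpha>: "\<forall>i<n. \<alpha> i \<le> v i" "x \<in> E n \<alpha>" unfolding K_def by blast
      have "x \<in> E n (\<lambda>i. if i < n then \<alpha> i else 0)"
        using \<alpha>(2) E_local[of n "\<lambda>i. if i < n then \<alpha> i else 0" \<alpha>] by simp
      moreover have "(\<lambda>i. if i < n then \<alpha> i else 0) \<in> T" using \<alpha>(1) unfolding T_def by simp
      ultimately show "x \<in> (\<Union>\<alpha>\<in>T. E n \<alpha>)" by blast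
    next
      fix x assume "x \<in> (\<Union>\<alpha>\<in>T. E n \<alpha>)"
      then show "x \<in> K n" unfolding K_def T_def by blast
    qed
    ultimately show ?thesis using E_sets by (auto intro!: sets.finite_UN)
  qed
  have "S n v \<subseteq> K n" for n
    unfolding S_def K_def using E_INT by blast
  then have K_big: "c < emeasure M (K n)" for n
    using big[of n] outer_measure_of_mono[of "S n v" "K n" M] K_sets[of n] by auto
  have "decseq K"
  proof (rule decseq_SucI)
    fix n show "K (Suc n) \<subseteq> K n"
      unfolding K_def by (rule UN_mono) (auto intro: E_anti[of n "Suc n", THEN subsetD])
  qed
  then have "emeasure M (\<Inter>n. K n) = (INF n. emeasure M (K n))"
    using K_sets by (intro INF_emeasure_decseq[symmetric]) auto
  then have "c \<le> emeasure M (\<Inter>n. K n)"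
    using K_big by (simp add: le_INF_iff less_imp_le)
  \<comment> \<open>A point may lie in each \<open>K n\<close> through a different sequence; the
    common bound v lets Koenig's lemma replace these by a single one.\<close>
  moreover have "(\<Inter>n. K n) \<subseteq> A"
  proof
    fix x assume x: "x \<in> (\<Inter>n. K n)"
    have "\<exists>\<alpha>. \<forall>n. x \<in> E n \<alpha>"
    proof (rule koenig_bounded)
      show "\<exists>\<alpha>. (\<forall>i<n. \<alpha> i \<le> v i) \<and> x \<in> E n \<alpha>" for n
        using x unfolding K_def by blast
      show "x \<in> E n \<alpha>'" if "\<forall>i<n. \<alpha>' i = \<alpha> i" "x \<in> E n \<alpha>" for n \<alpha> \<alpha>'
        using E_local[OF that(1)] that(2) by simp
      show "x \<in> E m \<alpha>" if "m \<le> n" "x \<in> E n \<alpha>" for m n \<alpha>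
        using E_anti[OF that(1)] that(2) by blast
    qed
    then show "x \<in> A" unfolding R(3) using E_INT by blast
  qed
  moreover have "(\<Inter>n. K n) \<in> sets M" using K_sets by auto
  ultimately show ?thesis by blast
qed

text \<open>A is squeezed between a measurable hull H and a countable union U of inner
  approximations of the same finite measure, so A differs from U by a subset of the null set H -
  U.\<close>

lemma (in finite_measure) suslin_sets_completion:
  assumes A: "A \<in> suslin (sets M)"
  shows "A \<in> sets (completion M)"
proof -
  have AM: "A \<subseteq> space M"
    using A sets.sets_into_space by (elim suslinE) blast
  obtain H where H: "H \<in> sets M" "A \<subseteq> H" "outer_measure_of M A = emeasure M H"
    using outer_measure_of_attain[OF AM] by blast
  define L where "L = {K \<in> sets M. K \<subseteq> A}"
  have "\<exists>K\<in>L. emeasure M H \<le> emeasure M K + ennreal (1 / Suc n)" for n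
  proof (cases "emeasure M H = 0")
    case True
    \<comment> \<open>Inner approximation needs a level strictly below the outer measure, which does
      not exist at 0.\<close>
    then show ?thesis by (intro bexI[of _ "{}"]) (auto simp: L_def)
  next
    case False
    define r where "r = measure M H"
    have r: "emeasure M H = ennreal r" "0 < r"
      using False by (auto simp: r_def emeasure_eq_measure zero_less_measure_iff)
    then have "ennreal (r - 1 / Suc n) < outer_measure_of M A"
      using H(3) by (simp add: ennreal_lessI)
    then obtain K where K: "K \<in> sets M" "K \<subseteq> A" "ennreal (r - 1 / Suc n) \<le> emeasure M K"
      using suslin_inner_approx[OF A] by metis
    \<comment> \<open>\<open>ennreal\<close> sends negative reals to 0, hence the maximum.\<close>
    have "ennreal r \<le> ennreal (max 0 (r - 1 / Suc n) + 1 / Suc n)"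
      by (intro ennreal_leI) simp
    also have "\<dots> = ennreal (r - 1 / Suc n) + ennreal (1 / Suc n)"
      by (simp add: ennreal_plus[symmetric] ennreal_neg max_def del: ennreal_plus)
    also have "\<dots> \<le> emeasure M K + ennreal (1 / Suc n)"
      using K(3) by (rule add_right_mono)
    finally show ?thesis
      using K(1,2) r(1) by (intro bexI[of _ K]) (auto simp: L_def)
  qed
  then obtain K where K: "\<And>n. K n \<in> L" "\<And>n. emeasure M H \<le> emeasure M (K n) + ennreal (1 / Suc n)"
    by metis
  define U where "U = (\<Union>n. K n)"
  have U: "U \<in> sets M" "U \<subseteq> A" using K(1) unfolding U_def L_def by auto
  have le: "emeasure M H \<le> emeasure M U + ennreal (1 / Suc n)" for n
    using K(2)[of n] emeasure_mono[of "K n" U M] U(1) unfolding U_def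
    by (meson UN_upper UNIV_I add_right_mono order_trans)
  have "(\<lambda>n. emeasure M U + ennreal (1 / Suc n)) \<longlonglongrightarrow> emeasure M U + ennreal 0"
    by (intro tendsto_add tendsto_const tendsto_ennrealI LIMSEQ_Suc[OF lim_1_over_n])
  then have "emeasure M H \<le> emeasure M U"
    using le by (intro LIMSEQ_le_const[of "\<lambda>n. emeasure M U + ennreal (1 / Suc n)"]) auto
  then have "emeasure M (H - U) = 0"
    using emeasure_Diff[of M U H] U H(1,2) emeasure_mono[of U H M] by (auto intro: order_antisym)
  then have "H - U \<in> null_sets M" using U H(1) by auto
  moreover have "A = U \<union> (A - U)" "A - U \<subseteq> H - U" using U H by auto
  ultimately show ?thesis using sets_completionI U(1) by blast
qed

section \<open>Projection along Baire space\<close>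

abbreviation baire :: "(nat \<Rightarrow> nat) measure" where
  "baire \<equiv> PiM UNIV (\<lambda>_. count_space UNIV)"

text \<open>The generating class has to be closed under complements, which rectangles are not. Sets
  with measurable sections that are locally constant in y are, and they include A x UNIV and the
  cylinders over a single coordinate of y, which generate the product.\<close>

lemma (in finite_measure) measurable_projection:
  assumes B: "B \<in> sets (M \<Otimes>\<^sub>M baire)"
  shows "fst ` B \<in> sets (completion M)"
proof -
  define G where "G = {B \<in> Pow (space M \<times> UNIV). locally_const (\<lambda>y. {x. (x, y) \<in> B}) \<and>
     (\<forall>y. {x. (x, y) \<in> B} \<in> sets M)}"
  have G_compl: "space M \<times> UNIV - A \<in> G" if "A \<in> G" for A
  proof -
    have eq: "{x. (x, y) \<in> space M \<times> UNIV - A} = space M - {x. (x, y) \<in> A}" for y by auto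
    have "locally_const (\<lambda>y. {x. (x, y) \<in> A})" and s: "\<And>y. {x. (x, y) \<in> A} \<in> sets M"
      using that unfolding G_def by auto
    then have "locally_const (\<lambda>y. space M - {x. (x, y) \<in> A})"
      unfolding locally_const_def by metis
    moreover have "\<forall>y. space M - {x. (x, y) \<in> A} \<in> sets M"
      using s by (intro allI sets.compl_sets)
    ultimately show ?thesis unfolding G_def mem_Collect_eq eq by blast
  qed
  have G_empty: "{} \<in> G" by (simp add: G_def locally_const_const)
  define N where "N = sigma (space M \<times> UNIV) G"
  have G_Pow: "G \<subseteq> Pow (space M \<times> UNIV)" by (auto simp: G_def)
  have N: "space N = space M \<times> UNIV" "sets N = sigma_sets (space M \<times> UNIV) G"
    using G_Pow by (simp_all add: N_def)
  have "fst \<in> N \<rightarrow>\<^sub>M M"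
  proof (rule measurableI)
    fix A assume A: "A \<in> sets M"
    have "locally_const (\<lambda>y :: nat \<Rightarrow> nat. {x. (x, y) \<in> A \<times> UNIV})"
      by (simp add: locally_const_const)
    then have "A \<times> UNIV \<in> G"
      using A sets.sets_into_space[OF A] by (auto simp: G_def)
    moreover have "fst -` A \<inter> space N = A \<times> UNIV"
      using sets.sets_into_space[OF A] N(1) by auto
    ultimately show "fst -` A \<inter> space N \<in> sets N" using N(2) by auto
  qed (auto simp: N)
  moreover have "snd \<in> N \<rightarrow>\<^sub>M baire"
  proof (rule measurable_PiM_single')
    fix i :: nat
    show "(\<lambda>\<omega>. snd \<omega> i) \<in> N \<rightarrow>\<^sub>M count_space UNIV"
    proof (rule measurableI)
      fix A :: "nat set"
      have "locally_const (\<lambda>y. {x. (x, y) \<in> space M \<times> {y. y i \<in> A}})"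
        unfolding locally_const_def by (intro allI exI[of _ "Suc i"]) auto
      moreover have "{x. (x, y) \<in> space M \<times> {y. y i \<in> A}} \<in> sets M" for y :: "nat \<Rightarrow> nat"
        by (cases "y i \<in> A") auto
      ultimately have "space M \<times> {y. y i \<in> A} \<in> G"
        by (auto simp: G_def)
      moreover have "(\<lambda>\<omega>. snd \<omega> i) -` A \<inter> space N = space M \<times> {y. y i \<in> A}"
        using N(1) by auto
      ultimately show "(\<lambda>\<omega>. snd \<omega> i) -` A \<inter> space N \<in> sets N" using N(2) by auto
    qed simp
  qed simp
  ultimately have "(\<lambda>z. (fst z, snd z)) \<in> N \<rightarrow>\<^sub>M M \<Otimes>\<^sub>M baire"
    by (rule measurable_Pair)
  from measurable_sets[OF this B] have "B \<inter> space N \<in> sets N"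
    by (simp add: vimage_def)
  moreover have "B \<subseteq> space N"
    using sets.sets_into_space[OF B] by (simp add: N space_pair_measure space_PiM)
  ultimately have "B \<in> sigma_sets (space M \<times> UNIV) G" using N(2) by (simp add: Int_absorb2)
  then have "B \<in> suslin G"
    using sigma_sets_subset_suslin[OF G_Pow G_empty G_compl] by blast
  then have "fst ` B \<in> suslin (sets M)"
    by (rule fst_image_suslin) (auto simp: G_def)
  then show ?thesis by (rule suslin_sets_completion)
qed

section \<open>Coding measurable functions by integer sequences\<close>

text \<open>The sets are the finite unions from a countable base. Outer regularity approximates A by
  an open U, and U is an increasing limit of such finite unions.\<close>

lemma dense_open_sequence:
  obtains B :: "nat \<Rightarrow> 'a::{second_countable_topology, complete_space} set" where
    "\<And>n. open (B n)"
    "\<And>P A e. finite_measure P \<Longrightarrow> sets P = sets borel \<Longrightarrow> A \<in> sets borel \<Longrightarrow> 0 < (e::real) \<Longrightarrow>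
       \<exists>n. measure P ((A - B n) \<union> (B n - A)) < e"
proof -
  obtain \<B> :: "'a set set" where \<B>: "countable \<B>" "topological_basis \<B>"
    using ex_countable_basis by blast
  define F where "F = Union ` {X. finite X \<and> X \<subseteq> insert {} \<B>}"
  have F_count: "countable F"
    unfolding F_def using \<B>(1) by (intro countable_image) (simp add: countable_Collect_finite_subset conj_commute)
  have "{} \<in> F" unfolding F_def by (rule image_eqI[of _ _ "{}"]) auto
  then have F_ne: "F \<noteq> {}" by blast
  have rangeF: "range (from_nat_into F) = F"
    by (rule range_from_nat_into[OF F_ne F_count])
  have F_open: "open V" if "V \<in> F" for V
    using that topological_basis_open[OF \<B>(2)] unfolding F_def by auto
  show thesis
  proof (rule that[of "from_nat_into F"])
    show "open (from_nat_into F n)" for n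
      using F_open rangeF by blast
    fix P :: "'a measure" and A :: "'a set" and e :: real
    assume P: "finite_measure P" "sets P = sets borel" and A: "A \<in> sets borel" and e: "0 < e"
    interpret P: finite_measure P by fact
    note [measurable_cong] = P(2)
    have [measurable]: "A \<in> sets P" using A P(2) by simp
    have "emeasure P A < emeasure P A + ennreal (e / 2)"
      using e by (simp add: P.emeasure_eq_measure ennreal_plus[symmetric] ennreal_less_iff del: ennreal_plus)
    moreover have "emeasure P A = (INF U \<in> {U. A \<subseteq> U \<and> open U}. emeasure P U)"
      using A P(2) P.emeasure_finite by (intro outer_regular) auto
    ultimately obtain U where U: "A \<subseteq> U" "open U" "emeasure P U < emeasure P A + ennreal (e / 2)"
      by (metis (no_types, lifting) INF_less_iff mem_Collect_eq)
    have U_meas: "measure P U < measure P A + e / 2"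
      using U(3) e by (simp add: P.emeasure_eq_measure ennreal_plus[symmetric] ennreal_less_iff del: ennreal_plus)
    obtain X where X: "X \<subseteq> \<B>" "\<Union>X = U"
      using \<B>(2) U(2) unfolding topological_basis_def by blast
    \<comment> \<open>The empty set is inserted because X may be empty and
      \<open>from_nat_into\<close> enumerates only non-empty sets.\<close>
    define b where "b = from_nat_into (insert {} X)"
    have b: "range b = insert {} X"
      unfolding b_def using \<B>(1) X(1) by (intro range_from_nat_into) (auto intro: countable_subset)
    define V where "V n = (\<Union>i<n. b i)" for n
    have V_F: "V n \<in> F" for n
      unfolding V_def F_def by (rule image_eqI[of _ _ "b ` {..<n}"]) (use b X(1) in auto)
    have V_sets[measurable]: "V n \<in> sets P" "U \<in> sets P" for n
      using F_open[OF V_F] U(2) P(2) by auto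
    have "(\<Union>n. V n) = \<Union>(range b)"
      unfolding V_def by (auto intro: lessI)
    then have V_UN: "(\<Union>n. V n) = U"
      using b X(2) by simp
    have "incseq V"
      unfolding V_def by (intro incseq_SucI UN_mono) auto
    then have "(\<lambda>n. measure P (V n)) \<longlonglongrightarrow> measure P U"
      unfolding V_UN[symmetric] by (intro P.finite_Lim_measure_incseq) auto
    then have "\<forall>\<^sub>F n in sequentially. measure P U - e / 2 < measure P (V n)"
      using e by (intro order_tendstoD(1)) auto
    then obtain n where n: "measure P U - e / 2 < measure P (V n)"
      by (meson eventually_sequentially order_refl)
    have VU: "V n \<subseteq> U" using V_UN by blast
    have "measure P ((A - V n) \<union> (V n - A)) \<le> measure P ((U - V n) \<union> (U - A))"
      using U(1) VU by (intro P.finite_measure_mono) auto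
    also have "\<dots> \<le> measure P (U - V n) + measure P (U - A)"
      by (intro measure_Un_le) auto
    also have "\<dots> = (measure P U - measure P (V n)) + (measure P U - measure P A)"
      using U(1) VU by (simp add: P.finite_measure_Diff)
    also have "\<dots> < e" using n U_meas by simp
    finally have "measure P ((A - V n) \<union> (V n - A)) < e" .
    then show "\<exists>n. measure P ((A - from_nat_into F n) \<union> (from_nat_into F n - A)) < e"
      using V_F rangeF by (metis rangeE)
  qed
qed

text \<open>A Borel set is recovered almost everywhere as the limsup of open sets
  \<open>B (y n)\<close>. A code for f has one row per rational r, coding the set where f < r, and f
  is the infimum of the rationals above it.\<close>

lemma universal_measurable_function:
  obtains h :: "(nat \<Rightarrow> nat) \<Rightarrow> 'a::{second_countable_topology, complete_space} \<Rightarrow> real" where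
    "(\<lambda>(y, w). h y w) \<in> borel_measurable (baire \<Otimes>\<^sub>M borel)"
    "\<And>P f. finite_measure P \<Longrightarrow> sets P = sets borel \<Longrightarrow> f \<in> borel_measurable borel \<Longrightarrow>
       \<exists>y. AE w in P. h y w = f w"
proof -
  obtain B :: "nat \<Rightarrow> 'a set" where B: "\<And>n. open (B n)"
    "\<And>P A e. finite_measure P \<Longrightarrow> sets P = sets borel \<Longrightarrow> A \<in> sets borel \<Longrightarrow> 0 < (e::real) \<Longrightarrow>
       \<exists>n. measure P ((A - B n) \<union> (B n - A)) < e"
    by (rule dense_open_sequence) blast
  have B_sets[measurable]: "B n \<in> sets borel" for n using B(1) by auto
  define in_lim where "in_lim y w \<longleftrightarrow> (\<forall>m. \<exists>n\<ge>m. w \<in> B (y n))" for y :: "nat \<Rightarrow> nat" and w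
  have set_code: "\<exists>y. AE w in P. in_lim y w \<longleftrightarrow> w \<in> A"
    if P: "finite_measure P" "sets P = sets borel" and A: "A \<in> sets borel" for P A
  proof -
    interpret P: finite_measure P by fact
    \<comment> \<open>Geometric errors are summable, so by Borel--Cantelli almost every point is
      misclassified only finitely often.\<close>
    have "\<exists>k. measure P ((A - B k) \<union> (B k - A)) < (1/2) ^ n" for n :: nat
      by (intro B(2) P A) simp
    then obtain y where y: "\<And>n. measure P ((A - B (y n)) \<union> (B (y n) - A)) < (1/2) ^ n"
      by metis
    have "AE w in P. \<forall>\<^sub>F n in sequentially. w \<in> space P - ((A - B (y n)) \<union> (B (y n) - A))"
    proof (rule borel_cantelli_AE1)
      show "(A - B (y n)) \<union> (B (y n) - A) \<in> sets P" for n
        using A P(2) by auto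
      show "summable (\<lambda>n. measure P ((A - B (y n)) \<union> (B (y n) - A)))"
        by (rule summable_comparison_test'[OF summable_geometric[of "1/2"], of 0])
          (use y in \<open>auto intro: less_imp_le\<close>)
    qed (simp add: P.emeasure_eq_measure)
    then have "AE w in P. in_lim y w \<longleftrightarrow> w \<in> A"
    proof eventually_elim
      case (elim w)
      then obtain M where M: "\<And>n. n \<ge> M \<Longrightarrow> w \<in> B (y n) \<longleftrightarrow> w \<in> A"
        unfolding eventually_sequentially by blast
      show ?case
      proof
        assume "in_lim y w"
        then obtain n where "n \<ge> M" "w \<in> B (y n)" unfolding in_lim_def by blast
        then show "w \<in> A" using M by simp
      next
        assume "w \<in> A"
        then have "w \<in> B (y (max m M))" for m using M[of "max m M"] by simp
        then show "in_lim y w" unfolding in_lim_def by (meson max.cobounded1)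
      qed
    qed
    then show ?thesis by blast
  qed
  define row where "row r y n = y (prod_encode (to_nat r, n))" for r :: rat and y :: "nat \<Rightarrow> nat" and n
  \<comment> \<open>An arbitrary code may produce an infinite infimum; \<open>real_of_ereal\<close>
    then returns 0, which keeps \<open>h\<close> real-valued and measurable for all y.\<close>
  define h where "h y w = real_of_ereal (INF r::rat. if in_lim (row r y) w then ereal (real_of_rat r) else \<infinity>)" for y w
  have [measurable]: "Measurable.pred (baire \<Otimes>\<^sub>M borel) (\<lambda>p. snd p \<in> B (fst p k))" for k
    by (rule measurable_compose_countable[where f="\<lambda>j p. snd p \<in> B j" and g="\<lambda>p. fst p k"]) measurable
  show thesis
  proof (rule that[of h])
    show "(\<lambda>(y, w). h y w) \<in> borel_measurable (baire \<Otimes>\<^sub>M borel)"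
      unfolding h_def in_lim_def row_def split_beta' by measurable
    fix P :: "'a measure" and f :: "'a \<Rightarrow> real"
    assume P: "finite_measure P" "sets P = sets borel" and [measurable]: "f \<in> borel_measurable borel"
    have "{w. f w < real_of_rat r} \<in> sets borel" for r
      by measurable
    then have "\<exists>y. AE w in P. in_lim y w \<longleftrightarrow> w \<in> {w. f w < real_of_rat r}" for r
      by (rule set_code[OF P])
    then obtain Y where Y: "\<And>r. AE w in P. in_lim (Y r) w \<longleftrightarrow> w \<in> {w. f w < real_of_rat r}"
      by metis
    define y where "y k = Y (from_nat (fst (prod_decode k))) (snd (prod_decode k))" for k
    have row_y: "row r y = Y r" for r
      unfolding row_def y_def by simp
    have "AE w in P. \<forall>r. in_lim (Y r) w \<longleftrightarrow> f w < real_of_rat r"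
      using Y by (simp add: AE_all_countable)
    then have "AE w in P. h y w = f w"
    proof eventually_elim
      case (elim w)
      have "(INF r::rat. if f w < real_of_rat r then ereal (real_of_rat r) else \<infinity>) = ereal (f w)"
      proof (rule antisym)
        show "ereal (f w) \<le> (INF r::rat. if f w < real_of_rat r then ereal (real_of_rat r) else \<infinity>)"
          by (intro INF_greatest) auto
        show "(INF r::rat. if f w < real_of_rat r then ereal (real_of_rat r) else \<infinity>) \<le> ereal (f w)"
        proof (rule dense_ge)
          fix t assume "ereal (f w) < t"
          then obtain s where s: "f w < s" "ereal s < t" using ereal_dense2[of "ereal (f w)" t] by auto
          obtain r where r: "f w < real_of_rat r" "real_of_rat r < s" using of_rat_dense[OF s(1)] by blast
          have "ereal (real_of_rat r) < ereal s" using r(2) by simp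
          also note s(2)
          finally show "(INF r::rat. if f w < real_of_rat r then ereal (real_of_rat r) else \<infinity>) \<le> t"
            using r(1) by (intro INF_lower2[of r]) auto
        qed
      qed
      then show ?case unfolding h_def row_y using elim by simp
    qed
    then show "\<exists>y. AE w in P. h y w = f w" by blast
  qed
qed

section \<open>Disintegration of couplings\<close>

text \<open>The hypothesis is tested on the set where g < f; finiteness of the integral of g makes
  the subtraction legitimate.\<close>

lemma AE_le_of_set_nn_integral_le:
  fixes f g :: "'a \<Rightarrow> ennreal"
  assumes [measurable]: "f \<in> borel_measurable M" "g \<in> borel_measurable M"
    and fin: "(\<integral>\<^sup>+x. g x \<partial>M) \<noteq> \<infinity>"
    and le: "\<And>A. A \<in> sets M \<Longrightarrow> (\<integral>\<^sup>+x\<in>A. f x \<partial>M) \<le> (\<integral>\<^sup>+x\<in>A. g x \<partial>M)"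
  shows "AE x in M. f x \<le> g x"
proof -
  define A where "A = {x \<in> space M. g x < f x}"
  have [measurable]: "A \<in> sets M" unfolding A_def by measurable
  have "(\<integral>\<^sup>+x\<in>A. g x \<partial>M) \<le> (\<integral>\<^sup>+x. g x \<partial>M)"
    by (intro nn_integral_mono) (auto simp: indicator_def)
  then have fin': "(\<integral>\<^sup>+x\<in>A. g x \<partial>M) \<noteq> \<infinity>" using fin by (auto simp: top_unique)
  have "(\<integral>\<^sup>+x. f x * indicator A x - g x * indicator A x \<partial>M) = (\<integral>\<^sup>+x\<in>A. f x \<partial>M) - (\<integral>\<^sup>+x\<in>A. g x \<partial>M)"
    using fin' by (intro nn_integral_diff) (auto simp: A_def indicator_def)
  also have "\<dots> = 0" using le[of A] fin' by (simp add: diff_eq_0_iff_ennreal less_top)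
  finally have "AE x in M. f x * indicator A x - g x * indicator A x = 0"
    by (subst (asm) nn_integral_0_iff_AE) auto
  with AE_space show ?thesis
  proof eventually_elim
    case (elim x)
    show ?case
    proof (rule ccontr)
      assume "\<not> f x \<le> g x"
      then have "g x < f x" "x \<in> A" using elim(1) by (auto simp: A_def)
      then show False using elim(2) by (auto simp: diff_eq_0_iff_ennreal)
    qed
  qed
qed

section \<open>Couplings realised with an independent uniform variable\<close>

abbreviation unif01 :: "real measure" where
  "unif01 \<equiv> uniform_measure lborel {0..1}"

lemma prob_space_unif01: "prob_space unif01"
  by (rule prob_space_uniform_measure) auto

lemma emeasure_unif01_less:
  assumes "S \<le> 1"
  shows "emeasure unif01 {u. ennreal u < S} = S"
proof -
  obtain s where s: "S = ennreal s" "0 \<le> s" "s \<le> 1"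
    using assms by (cases S) (auto simp: top_unique)
  \<comment> \<open>Negative u satisfy \<open>ennreal u = 0\<close> and may lie in the set; the
    intersection with the unit interval discards them.\<close>
  have "{0..1} \<inter> {u. ennreal u < S} = {0..<s}"
    using s by (auto simp: ennreal_less_iff)
  moreover have "{u. ennreal u < S} \<in> sets lborel" by simp
  ultimately show ?thesis using s by (simp add: divide_ennreal_def)
qed

text \<open>The conditional distribution functions are Radon--Nikodym derivatives at the rationals,
  and \<open>g\<close> is their quantile transform. It is built with values in \<open>ereal\<close>, so that the infimum
  is well behaved on the exceptional null set.\<close>

lemma kernel_representation:
  fixes \<pi> :: "('a \<times> real) measure"
  assumes "prob_space \<pi>" and sets_\<pi>: "sets \<pi> = sets (N \<Otimes>\<^sub>M borel)"
  obtains g :: "'a \<Rightarrow> real \<Rightarrow> real" where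
    "(\<lambda>(y, u). g y u) \<in> borel_measurable (N \<Otimes>\<^sub>M borel)"
    "distr (distr \<pi> N fst \<Otimes>\<^sub>M unif01) (N \<Otimes>\<^sub>M borel) (\<lambda>(y, u). (y, g y u)) = \<pi>"
proof -
  interpret \<pi>: prob_space \<pi> by fact
  interpret U: prob_space unif01 by (rule prob_space_unif01)
  note [measurable_cong] = sets_\<pi>
  define \<eta> where "\<eta> = distr \<pi> N fst"
  have sets_\<eta>[simp, measurable_cong]: "sets \<eta> = sets N" and space_\<eta>[simp]: "space \<eta> = space N"
    by (simp_all add: \<eta>_def)
  interpret \<eta>: prob_space \<eta>
    unfolding \<eta>_def by (rule \<pi>.prob_space_distr) simp
  have space_\<pi>: "space \<pi> = space N \<times> UNIV"
    using sets_eq_imp_space_eq[OF sets_\<pi>] by (simp add: space_pair_measure)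
  \<comment> \<open>The part of \<pi> with second coordinate below r, projected to the first; its
    density with respect to \<eta> is the conditional probability of that event given y.\<close>
  define \<nu> where "\<nu> r = distr (density \<pi> (\<lambda>z. indicator {..<real_of_rat r} (snd z))) N fst" for r
  have [simp, measurable_cong]: "sets (\<nu> r) = sets N" for r by (simp add: \<nu>_def)
  have rect[measurable]: "A \<times> B \<in> sets \<pi>" if "A \<in> sets N" "B \<in> sets borel" for A B
    using that by (simp add: sets_\<pi>)
  have \<nu>: "emeasure (\<nu> r) A = emeasure \<pi> (A \<times> {..<real_of_rat r})" if [measurable]: "A \<in> sets N" for r A
  proof -
    have "emeasure (\<nu> r) A = emeasure (density \<pi> (\<lambda>z. indicator {..<real_of_rat r} (snd z))) (A \<times> UNIV)"
      unfolding \<nu>_def using sets.sets_into_space[OF that]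
      by (subst emeasure_distr) (auto simp: space_\<pi> intro!: arg_cong2[where f=emeasure])
    also have "\<dots> = (\<integral>\<^sup>+z. indicator (A \<times> {..<real_of_rat r}) z \<partial>\<pi>)"
    proof (subst emeasure_density)
      show "(\<integral>\<^sup>+z. indicator {..<real_of_rat r} (snd z) * indicator (A \<times> UNIV) z \<partial>\<pi>) =
          (\<integral>\<^sup>+z. indicator (A \<times> {..<real_of_rat r}) z \<partial>\<pi>)"
        by (rule nn_integral_cong) (auto simp: indicator_def)
    qed auto
    finally show ?thesis by simp
  qed
  have \<eta>: "emeasure \<eta> A = emeasure \<pi> (A \<times> UNIV)" if [measurable]: "A \<in> sets N" for A
    unfolding \<eta>_def using sets.sets_into_space[OF that]
    by (subst emeasure_distr) (auto simp: space_\<pi> intro!: arg_cong2[where f=emeasure])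
  have ac: "absolutely_continuous \<eta> (\<nu> r)" for r
    unfolding absolutely_continuous_def
  proof
    fix A assume A: "A \<in> null_sets \<eta>"
    then have [measurable]: "A \<in> sets N" by auto
    have "emeasure \<pi> (A \<times> {..<real_of_rat r}) \<le> emeasure \<pi> (A \<times> UNIV)"
      by (intro emeasure_mono) auto
    then show "A \<in> null_sets (\<nu> r)"
      using A \<nu>[of A r] \<eta>[of A] by (auto intro!: null_setsI)
  qed
  define G where "G r = RN_deriv \<eta> (\<nu> r)" for r
  have G_meas[measurable]: "G r \<in> borel_measurable N" for r
    using borel_measurable_RN_deriv[of \<eta> "\<nu> r"] unfolding G_def by simp
  have G_int: "(\<integral>\<^sup>+y\<in>A. G r y \<partial>\<eta>) = emeasure \<pi> (A \<times> {..<real_of_rat r})" if "A \<in> sets N" for r A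
  proof -
    have "(\<integral>\<^sup>+y\<in>A. G r y \<partial>\<eta>) = emeasure (density \<eta> (G r)) A"
      using that by (subst emeasure_density) auto
    also have "density \<eta> (G r) = \<nu> r"
      unfolding G_def by (rule \<eta>.density_RN_deriv[OF ac]) simp
    finally show ?thesis using \<nu>[OF that] by simp
  qed
  have G_mono: "AE y in \<eta>. G r y \<le> G s y" if "r \<le> s" for r s
  proof (rule AE_le_of_set_nn_integral_le)
    have "(\<integral>\<^sup>+y. G s y \<partial>\<eta>) = (\<integral>\<^sup>+y\<in>space N. G s y \<partial>\<eta>)"
      by (intro nn_integral_cong) simp
    then show "(\<integral>\<^sup>+y. G s y \<partial>\<eta>) \<noteq> \<infinity>" by (simp add: G_int)
    show "(\<integral>\<^sup>+y\<in>A. G r y \<partial>\<eta>) \<le> (\<integral>\<^sup>+y\<in>A. G s y \<partial>\<eta>)" if "A \<in> sets \<eta>" for A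
      using that \<open>r \<le> s\<close> of_rat_less_eq[of r s, where 'a=real]
      by (simp add: G_int) (intro emeasure_mono; auto)
  qed auto
  have G_le1: "AE y in \<eta>. G r y \<le> 1" for r
  proof (rule AE_le_of_set_nn_integral_le)
    show "(\<integral>\<^sup>+y\<in>A. G r y \<partial>\<eta>) \<le> (\<integral>\<^sup>+y\<in>A. 1 \<partial>\<eta>)" if "A \<in> sets \<eta>" for A
      using that by (simp add: G_int \<eta>) (intro emeasure_mono; auto)
  qed (auto simp: \<eta>.emeasure_space_1)
  \<comment> \<open>Each inequality holds off its own null set; as the rationals are countable, one
    null set serves them all.\<close>
  have good: "AE y in \<eta>. (\<forall>r s. r \<le> s \<longrightarrow> G r y \<le> G s y) \<and> (\<forall>r. G r y \<le> 1)"
    using G_mono G_le1 by (simp add: AE_all_countable AE_conj_iff)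

  define h :: "'a \<Rightarrow> real \<Rightarrow> ereal"
    where "h y u = (INF r::rat. if ennreal u < G r y then ereal (real_of_rat r) else \<infinity>)" for y u
  have h_meas[measurable]: "(\<lambda>(y, u). h y u) \<in> borel_measurable (N \<Otimes>\<^sub>M borel)"
    unfolding h_def by measurable
  \<comment> \<open>An infimum is below t exactly when some member is, so the strict inequalities
    make this hold for every y, also where the derivatives fail to be monotone.\<close>
  have h_less: "h y u < t \<longleftrightarrow> (\<exists>r\<in>{r. ereal (real_of_rat r) < t}. ennreal u < G r y)" for y u t
    unfolding h_def INF_less_iff by (auto split: if_splits)
  define P1 where "P1 = distr (\<eta> \<Otimes>\<^sub>M unif01) (N \<Otimes>\<^sub>M borel) (\<lambda>(y, u). (y, h y u))"
  define P2 where "P2 = distr \<pi> (N \<Otimes>\<^sub>M borel) (\<lambda>(y, z). (y, ereal z))"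
  have P1: "emeasure P1 (A \<times> B) = (\<integral>\<^sup>+y\<in>A. emeasure unif01 {u. h y u \<in> B} \<partial>\<eta>)"
    if [measurable]: "A \<in> sets N" "B \<in> sets borel" for A and B :: "ereal set"
  proof -
    define V where "V = (\<lambda>(y, u). (y, h y u)) -` (A \<times> B) \<inter> space (\<eta> \<Otimes>\<^sub>M unif01)"
    have V: "V \<in> sets (\<eta> \<Otimes>\<^sub>M unif01)"
      unfolding V_def by measurable
    have "emeasure P1 (A \<times> B) = emeasure (\<eta> \<Otimes>\<^sub>M unif01) V"
      unfolding P1_def V_def by (subst emeasure_distr) auto
    also have "\<dots> = (\<integral>\<^sup>+y. emeasure unif01 (Pair y -` V) \<partial>\<eta>)"
      by (rule U.emeasure_pair_measure_alt[OF V])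
    also have "\<dots> = (\<integral>\<^sup>+y\<in>A. emeasure unif01 {u. h y u \<in> B} \<partial>\<eta>)"
    proof (rule nn_integral_cong)
      fix y assume "y \<in> space \<eta>"
      then have "Pair y -` V = (if y \<in> A then {u. h y u \<in> B} else {})"
        by (auto simp: V_def space_pair_measure)
      then show "emeasure unif01 (Pair y -` V) = emeasure unif01 {u. h y u \<in> B} * indicator A y"
        by (cases "y \<in> A") (simp_all del: emeasure_uniform_measure)
    qed
    finally show ?thesis .
  qed
  have P2: "emeasure P2 (A \<times> B) = emeasure \<pi> (A \<times> {z. ereal z \<in> B})"
    if [measurable]: "A \<in> sets N" "B \<in> sets borel" for A and B :: "ereal set"
    unfolding P2_def using sets.sets_into_space[OF that(1)]
    by (subst emeasure_distr) (auto simp: space_\<pi> intro!: arg_cong2[where f=emeasure])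
  have eq_UNIV: "emeasure P1 (A \<times> UNIV) = emeasure P2 (A \<times> UNIV)" if "A \<in> sets N" for A
    using that U.emeasure_space_1 by (simp add: P1 P2 \<eta>)
  have eq_less: "emeasure P1 (A \<times> {..<t}) = emeasure P2 (A \<times> {..<t})"
    if [measurable]: "A \<in> sets N" for A t
  proof (cases "t = -\<infinity>")
    case True
    then have "{..<t} = {}" by auto
    then show ?thesis by simp
  next
    case False
    define T where "T = {r. ereal (real_of_rat r) < t}"
    have T_ex: "\<exists>r\<in>T. z < real_of_rat r" if "ereal z < t" for z
    proof -
      obtain w where w: "z < w" "ereal w < t"
        using ereal_dense2[OF \<open>ereal z < t\<close>] by auto
      obtain r where "z < real_of_rat r" "real_of_rat r < w"
        using of_rat_dense[OF w(1)] by blast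
      then show ?thesis using w(2) unfolding T_def
        by (intro bexI[of _ r]) (auto intro: less_trans[of _ "ereal w"])
    qed
    obtain z0 where "ereal z0 < t" using False ereal_dense2[of "-\<infinity>" t] by (auto simp: less_le)
    then have T_ne: "T \<noteq> {}" using T_ex by blast
    define e where "e = from_nat_into T"
    have e: "range e = T" unfolding e_def by (rule range_from_nat_into) (use T_ne in auto)
    \<comment> \<open>Running maxima of an enumeration of T form an increasing sequence with the
      same supremum, as monotone convergence requires.\<close>
    define m where "m n = Max (e ` {..n})" for n
    have m_T: "m n \<in> T" for n
    proof -
      have "m n \<in> e ` {..n}" unfolding m_def by (rule Max_in) auto
      then show ?thesis using e by auto
    qed
    have e_le: "e n \<le> m n" for n unfolding m_def by (rule Max_ge) auto
    have m_Suc: "m n \<le> m (Suc n)" for n unfolding m_def by (rule Max_mono) auto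
    have "emeasure P1 (A \<times> {..<t}) = (\<integral>\<^sup>+y\<in>A. emeasure unif01 {u. h y u < t} \<partial>\<eta>)"
      by (subst P1) auto
    also have "\<dots> = (\<integral>\<^sup>+y. (SUP n. G (m n) y * indicator A y) \<partial>\<eta>)"
    proof (rule nn_integral_cong_AE)
      show "AE y in \<eta>. emeasure unif01 {u. h y u < t} * indicator A y = (SUP n. G (m n) y * indicator A y)"
        using good
      proof eventually_elim
        case (elim y)
        have sup: "(SUP r\<in>T. G r y) = (SUP n. G (m n) y)"
        proof (rule antisym)
          show "(SUP r\<in>T. G r y) \<le> (SUP n. G (m n) y)"
          proof (rule SUP_least)
            fix r assume "r \<in> T"
            then obtain n where "r = e n" using e by blast
            then have "G r y \<le> G (m n) y" using elim e_le by blast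
            then show "G r y \<le> (SUP n. G (m n) y)" by (rule SUP_upper2[rotated]) simp
          qed
          show "(SUP n. G (m n) y) \<le> (SUP r\<in>T. G r y)"
            using m_T by (auto intro!: SUP_least SUP_upper)
        qed
        have "{u. h y u < t} = {u. ennreal u < (SUP r\<in>T. G r y)}"
          unfolding h_less T_def by (simp add: less_SUP_iff)
        moreover have "(SUP r\<in>T. G r y) \<le> 1" using elim by (auto intro!: SUP_least)
        ultimately have "emeasure unif01 {u. h y u < t} = (SUP n. G (m n) y)"
          using emeasure_unif01_less sup by simp
        then show ?case by (cases "y \<in> A") auto
      qed
    qed
    also have "\<dots> = (SUP n. \<integral>\<^sup>+y\<in>A. G (m n) y \<partial>\<eta>)"
    proof (rule nn_integral_monotone_convergence_SUP_AE)
      show "AE y in \<eta>. G (m n) y * indicator A y \<le> G (m (Suc n)) y * indicator A y" for n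
        using G_mono[OF m_Suc[of n]] by eventually_elim (auto simp: indicator_def)
    qed simp
    also have "\<dots> = (SUP n. emeasure \<pi> (A \<times> {..<real_of_rat (m n)}))"
      by (simp add: G_int)
    also have "\<dots> = emeasure \<pi> (\<Union>n. A \<times> {..<real_of_rat (m n)})"
    proof (rule SUP_emeasure_incseq)
      show "incseq (\<lambda>n. A \<times> {..<real_of_rat (m n)})"
        using m_Suc by (intro incseq_SucI) (auto intro: less_le_trans simp: of_rat_less_eq)
    qed auto
    also have "(\<Union>n. A \<times> {..<real_of_rat (m n)}) = A \<times> {z. ereal z \<in> {..<t}}"
    proof (intro equalityI subsetI)
      fix p assume "p \<in> (\<Union>n. A \<times> {..<real_of_rat (m n)})"
      then obtain n where "fst p \<in> A" "snd p < real_of_rat (m n)" by auto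
      moreover have "ereal (real_of_rat (m n)) < t" using m_T unfolding T_def by auto
      ultimately show "p \<in> A \<times> {z. ereal z \<in> {..<t}}"
        by (auto simp: mem_Times_iff intro: less_trans[of _ "ereal (real_of_rat (m n))"])
    next
      fix p assume p: "p \<in> A \<times> {z. ereal z \<in> {..<t}}"
      then obtain r where "r \<in> T" "snd p < real_of_rat r" using T_ex by (auto simp: mem_Times_iff)
      moreover then obtain n where "r = e n" using e by blast
      ultimately have "snd p < real_of_rat (m n)"
        using e_le[of n] by (auto intro: less_le_trans simp: of_rat_less_eq)
      then show "p \<in> (\<Union>n. A \<times> {..<real_of_rat (m n)})" using p by (auto simp: mem_Times_iff)
    qed
    also have "emeasure \<pi> \<dots> = emeasure P2 (A \<times> {..<t})"
      by (subst P2) auto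
    finally show ?thesis .
  qed
  have P_eq: "P1 = P2"
  proof (rule measure_eqI_generator_eq_countable)
    \<comment> \<open>The half-lines all miss the point \<infinity>, so UNIV is added to let the
      generator contain the whole space.\<close>
    define Eb where "Eb = insert UNIV (range lessThan :: ereal set set)"
    let ?E = "{a \<times> b | a b. a \<in> sets N \<and> b \<in> Eb}"
    have "sets (borel :: ereal measure) = sigma_sets UNIV Eb"
    proof (rule antisym)
      show "sets (borel :: ereal measure) \<subseteq> sigma_sets UNIV Eb"
        unfolding borel_Iio by (subst sets_measure_of) (auto simp: Eb_def intro!: sigma_sets_mono)
      show "sigma_sets UNIV Eb \<subseteq> sets (borel :: ereal measure)"
        by (rule sets.sigma_sets_subset[of _ borel, simplified]) (auto simp: Eb_def)
    qed
    then have "sets (N \<Otimes>\<^sub>M (borel :: ereal measure)) = sets (sigma (space N \<times> space borel) ?E)"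
      by (intro sets_pair_eq[where Ca="{space N}" and Cb="{UNIV}"])
        (auto simp: Eb_def sets.space_closed sets.sigma_sets_eq)
    also have "\<dots> = sigma_sets (space N \<times> UNIV) ?E"
      using sets.sets_into_space by (subst sets_measure_of) auto
    finally have E: "sets (N \<Otimes>\<^sub>M (borel :: ereal measure)) = sigma_sets (space N \<times> UNIV) ?E" .
    show "sets P1 = sigma_sets (space N \<times> UNIV) ?E" "sets P2 = sigma_sets (space N \<times> UNIV) ?E"
      unfolding P1_def P2_def using E by simp_all
    have "{..<x} \<inter> {..<y} = {..<min x y}" for x y :: ereal by auto
    then have Eb_Int: "b \<inter> b' \<in> Eb" if "b \<in> Eb" "b' \<in> Eb" for b b'
      using that unfolding Eb_def by auto
    show "Int_stable ?E"
    proof (rule Int_stableI)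
      fix x y assume "x \<in> ?E" "y \<in> ?E"
      then obtain a b a' b' where "x = a \<times> b" "y = a' \<times> b'" "a \<in> sets N" "a' \<in> sets N" "b \<in> Eb" "b' \<in> Eb"
        by blast
      then have "x \<inter> y = (a \<inter> a') \<times> (b \<inter> b')" "a \<inter> a' \<in> sets N" "b \<inter> b' \<in> Eb"
        using Eb_Int by auto
      then show "x \<inter> y \<in> ?E" by blast
    qed
    show "emeasure P1 X = emeasure P2 X" if "X \<in> ?E" for X
      using that eq_UNIV eq_less unfolding Eb_def by auto
    show "?E \<subseteq> Pow (space N \<times> UNIV)"
      using sets.sets_into_space by auto
    show "{space N \<times> UNIV} \<subseteq> ?E" by (auto simp: Eb_def)
    show "emeasure P1 a \<noteq> \<infinity>" if "a \<in> {space N \<times> UNIV}" for a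
      using that eq_UNIV[of "space N"] by (simp add: P2)
  qed auto
  show thesis
  proof (rule that[of "\<lambda>y u. real_of_ereal (h y u)"])
    show "(\<lambda>(y, u). real_of_ereal (h y u)) \<in> borel_measurable (N \<Otimes>\<^sub>M borel)"
      by measurable
    \<comment> \<open>P2 lives on finite values, where \<open>real_of_ereal\<close> undoes
      \<open>ereal\<close>; equality of laws transfers this to P1.\<close>
    have "distr (\<eta> \<Otimes>\<^sub>M unif01) (N \<Otimes>\<^sub>M borel) (\<lambda>(y, u). (y, real_of_ereal (h y u))) =
        distr P1 (N \<Otimes>\<^sub>M borel) (\<lambda>(y, z). (y, real_of_ereal z))"
      unfolding P1_def by (subst distr_distr) (auto simp: comp_def split_beta')
    also have "\<dots> = distr \<pi> (N \<Otimes>\<^sub>M borel) (\<lambda>z. z)"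
      unfolding P_eq P2_def by (subst distr_distr) (auto simp: comp_def split_beta')
    also have "\<dots> = \<pi>"
      by (rule distr_id2) (simp add: sets_\<pi>)
    finally show "distr (distr \<pi> N fst \<Otimes>\<^sub>M unif01) (N \<Otimes>\<^sub>M borel) (\<lambda>(y, u). (y, real_of_ereal (h y u))) = \<pi>"
      unfolding \<eta>_def .
  qed
qed

section \<open>The fused Gromov--Wasserstein discrepancy\<close>

definition fgw_cost :: "real \<Rightarrow> (real \<Rightarrow> real \<Rightarrow> real) \<Rightarrow> (real \<times> real) measure \<Rightarrow> ennreal" where
  "fgw_cost \<beta> d1 \<pi> =
     ennreal (1 - \<beta>) * (\<integral>\<^sup>+ p. ennreal (d1 (fst p) (snd p)) \<partial>\<pi>)
   + ennreal \<beta> * (\<integral>\<^sup>+ p. (\<integral>\<^sup>+ q. ennreal ((d1 (fst p) (fst q) - d1 (snd p) (snd q))\<^sup>2) \<partial>\<pi>) \<partial>\<pi>)"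

lemma D_fgw_eq: "D_fgw \<rho> \<eta> \<beta> d1 = (INF \<pi>\<in>couplings \<rho> \<eta>. fgw_cost \<beta> d1 \<pi>)"
  unfolding D_fgw_def fgw_cost_def ..

lemma sets_borel_prod_real: "sets (borel :: (real \<times> real) measure) = sets (borel \<Otimes>\<^sub>M borel)"
  by (subst borel_prod) (rule refl)

lemma measurable_curried:
  assumes "case_prod f \<in> borel_measurable (borel :: (real \<times> real) measure)"
    and [measurable]: "X \<in> borel_measurable M" "Y \<in> borel_measurable M"
  shows "(\<lambda>w. f (X w) (Y w) :: real) \<in> borel_measurable M"
proof -
  have "(\<lambda>w. (X w, Y w)) \<in> M \<rightarrow>\<^sub>M borel" by simp
  from measurable_compose[OF this assms(1)] show ?thesis by simp
qed

text \<open>On a common space P, costs of different couplings can be compared integrand by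
  integrand, and for sliced measures the direction appears only in the integrand.\<close>

lemma fgw_cost_distr:
  assumes "prob_space P" and [measurable]: "X \<in> borel_measurable P" "Y \<in> borel_measurable P"
    and d1: "case_prod d1 \<in> borel_measurable (borel :: (real \<times> real) measure)"
  shows "fgw_cost \<beta> d1 (distr P borel (\<lambda>w. (X w, Y w))) =
     ennreal (1 - \<beta>) * (\<integral>\<^sup>+ w. ennreal (d1 (X w) (Y w)) \<partial>P)
   + ennreal \<beta> * (\<integral>\<^sup>+ w. (\<integral>\<^sup>+ v. ennreal ((d1 (X w) (X v) - d1 (Y w) (Y v))\<^sup>2) \<partial>P) \<partial>P)"
proof -
  interpret prob_space P by fact
  note [measurable] = measurable_curried[OF d1]
  define \<pi> where "\<pi> = distr P borel (\<lambda>w. (X w, Y w))"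
  note [measurable_cong] = sets_borel_prod_real
  have [measurable_cong, simp]: "sets \<pi> = sets borel" by (simp add: \<pi>_def)
  interpret \<pi>: prob_space \<pi> unfolding \<pi>_def by (rule prob_space_distr) simp
  have "(\<integral>\<^sup>+ p. ennreal (d1 (fst p) (snd p)) \<partial>\<pi>) = (\<integral>\<^sup>+ w. ennreal (d1 (X w) (Y w)) \<partial>P)"
    unfolding \<pi>_def by (subst nn_integral_distr) auto
  moreover have "(\<integral>\<^sup>+ p. (\<integral>\<^sup>+ q. ennreal ((d1 (fst p) (fst q) - d1 (snd p) (snd q))\<^sup>2) \<partial>\<pi>) \<partial>\<pi>) =
     (\<integral>\<^sup>+ w. (\<integral>\<^sup>+ q. ennreal ((d1 (X w) (fst q) - d1 (Y w) (snd q))\<^sup>2) \<partial>\<pi>) \<partial>P)"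
  proof -
    define I where "I p = (\<integral>\<^sup>+ q. ennreal ((d1 (fst p) (fst q) - d1 (snd p) (snd q))\<^sup>2) \<partial>\<pi>)" for p
    have I: "I \<in> borel_measurable borel"
      unfolding I_def by measurable
    have "(\<integral>\<^sup>+ p. I p \<partial>distr P borel (\<lambda>w. (X w, Y w))) = (\<integral>\<^sup>+ w. I (X w, Y w) \<partial>P)"
      by (rule nn_integral_distr) (use I in auto)
    then show ?thesis unfolding \<pi>_def[symmetric] by (simp add: I_def)
  qed
  moreover have "(\<integral>\<^sup>+ q. ennreal ((d1 x (fst q) - d1 y (snd q))\<^sup>2) \<partial>\<pi>) =
      (\<integral>\<^sup>+ v. ennreal ((d1 x (X v) - d1 y (Y v))\<^sup>2) \<partial>P)" for x y
    unfolding \<pi>_def by (subst nn_integral_distr) auto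
  ultimately show ?thesis
    unfolding fgw_cost_def \<pi>_def[symmetric] by simp
qed

section \<open>Quasi-triangle inequality and symmetry of the discrepancy\<close>

lemma square_diff_le: "(a - c :: real)\<^sup>2 \<le> 2 * ((a - b)\<^sup>2 + (b - c)\<^sup>2)"
proof -
  have "2 * ((a - b)\<^sup>2 + (b - c)\<^sup>2) - (a - c)\<^sup>2 = (a - 2 * b + c)\<^sup>2"
    by (simp add: power2_eq_square algebra_simps)
  then show ?thesis by (metis diff_ge_0_iff_ge zero_le_power2)
qed

text \<open>In the quadratic term a, b, c of \<open>square_diff_le\<close> are the values of
  \<open>d1\<close> on two independent copies of X, Y, Z, so the inequality there is one between
  real numbers. One K serves both terms because it is at least 2.\<close>

lemma fgw_cost_triangle:
  assumes "prob_space P"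
    and XYZ[measurable]: "X \<in> borel_measurable P" "Y \<in> borel_measurable P" "Z \<in> borel_measurable P"
    and d1: "case_prod d1 \<in> borel_measurable (borel :: (real \<times> real) measure)"
    and nonneg: "\<And>x y. 0 \<le> d1 x y"
    and tri: "\<And>x y z. d1 x z \<le> K * (d1 x y + d1 y z)" and K: "2 \<le> K"
  shows "fgw_cost \<beta> d1 (distr P borel (\<lambda>w. (X w, Z w))) \<le>
    ennreal K * (fgw_cost \<beta> d1 (distr P borel (\<lambda>w. (X w, Y w))) + fgw_cost \<beta> d1 (distr P borel (\<lambda>w. (Y w, Z w))))"
proof -
  interpret prob_space P by fact
  note [measurable] = measurable_curried[OF d1]
  let ?L = "\<lambda>X Y. \<integral>\<^sup>+ w. ennreal (d1 (X w) (Y w)) \<partial>P"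
  let ?Q = "\<lambda>X Y. \<integral>\<^sup>+ w. (\<integral>\<^sup>+ v. ennreal ((d1 (X w) (X v) - d1 (Y w) (Y v))\<^sup>2) \<partial>P) \<partial>P"
  have "?L X Z \<le> (\<integral>\<^sup>+ w. ennreal K * (ennreal (d1 (X w) (Y w)) + ennreal (d1 (Y w) (Z w))) \<partial>P)"
    using tri nonneg K
    by (intro nn_integral_mono) (simp add: ennreal_plus[symmetric] ennreal_mult'[symmetric] ennreal_leI del: ennreal_plus)
  also have "\<dots> = ennreal K * (?L X Y + ?L Y Z)"
    by (simp add: nn_integral_cmult nn_integral_add)
  finally have L: "?L X Z \<le> ennreal K * (?L X Y + ?L Y Z)" .
  have sq: "ennreal ((a - c)\<^sup>2) \<le> ennreal K * (ennreal ((a - b)\<^sup>2) + ennreal ((b - c)\<^sup>2))" for a b c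
  proof -
    have "(a - c)\<^sup>2 \<le> K * ((a - b)\<^sup>2 + (b - c)\<^sup>2)"
      using square_diff_le[of a c b] mult_right_mono[OF K, of "(a - b)\<^sup>2 + (b - c)\<^sup>2"] by simp
    then show ?thesis
      using K by (simp add: ennreal_plus[symmetric] ennreal_mult'[symmetric] ennreal_leI del: ennreal_plus)
  qed
  have "?Q X Z \<le> (\<integral>\<^sup>+ w. (\<integral>\<^sup>+ v. ennreal K * (ennreal ((d1 (X w) (X v) - d1 (Y w) (Y v))\<^sup>2)
      + ennreal ((d1 (Y w) (Y v) - d1 (Z w) (Z v))\<^sup>2)) \<partial>P) \<partial>P)"
    by (intro nn_integral_mono sq)
  also have "\<dots> = ennreal K * (?Q X Y + ?Q Y Z)"
    by (simp add: nn_integral_cmult nn_integral_add)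
  finally have Q: "?Q X Z \<le> ennreal K * (?Q X Y + ?Q Y Z)" .
  have "ennreal (1 - \<beta>) * ?L X Z + ennreal \<beta> * ?Q X Z \<le>
      ennreal (1 - \<beta>) * (ennreal K * (?L X Y + ?L Y Z)) + ennreal \<beta> * (ennreal K * (?Q X Y + ?Q Y Z))"
    using L Q by (intro add_mono mult_left_mono) auto
  also have "\<dots> = ennreal K * ((ennreal (1 - \<beta>) * ?L X Y + ennreal \<beta> * ?Q X Y)
      + (ennreal (1 - \<beta>) * ?L Y Z + ennreal \<beta> * ?Q Y Z))"
    by (simp add: distrib_left mult_ac add_ac)
  finally show ?thesis
    unfolding fgw_cost_distr[OF assms(1) XYZ(1,3) d1] fgw_cost_distr[OF assms(1) XYZ(1,2) d1]
      fgw_cost_distr[OF assms(1) XYZ(2,3) d1] .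
qed

text \<open>Gluing: if \<open>\<pi>2\<close> is the law of \<open>(y, g y u)\<close>, then \<open>(x, y, g y u)\<close> under \<open>\<pi>1 \<Otimes>\<^sub>M unif01\<close> has
  the pair marginals \<open>\<pi>1\<close> and \<open>\<pi>2\<close>.\<close>

lemma couplings_glue:
  assumes \<pi>1: "\<pi>1 \<in> couplings \<rho> \<eta>" and \<pi>2: "\<pi>2 \<in> couplings \<eta> \<zeta>"
  obtains P :: "((real \<times> real) \<times> real) measure" and X Y Z where "prob_space P"
    "X \<in> borel_measurable P" "Y \<in> borel_measurable P" "Z \<in> borel_measurable P"
    "distr P borel (\<lambda>w. (X w, Y w)) = \<pi>1" "distr P borel (\<lambda>w. (Y w, Z w)) = \<pi>2"
    "distr P borel (\<lambda>w. (X w, Z w)) \<in> couplings \<rho> \<zeta>"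
proof -
  from \<pi>1 have p1: "sets \<pi>1 = sets borel" "prob_space \<pi>1" "distr \<pi>1 borel fst = \<rho>" "distr \<pi>1 borel snd = \<eta>"
    by (auto simp: couplings_def)
  from \<pi>2 have p2: "sets \<pi>2 = sets borel" "prob_space \<pi>2" "distr \<pi>2 borel fst = \<eta>" "distr \<pi>2 borel snd = \<zeta>"
    by (auto simp: couplings_def)
  interpret \<pi>1: prob_space \<pi>1 by fact
  interpret U: prob_space unif01 by (rule prob_space_unif01)
  note [measurable_cong] = sets_borel_prod_real p1(1)
  obtain g :: "real \<Rightarrow> real \<Rightarrow> real" where
    g[measurable]: "(\<lambda>(y, u). g y u) \<in> borel_measurable (borel \<Otimes>\<^sub>M borel)" and
    g_eq: "distr (distr \<pi>2 borel fst \<Otimes>\<^sub>M unif01) (borel \<Otimes>\<^sub>M borel) (\<lambda>(y, u). (y, g y u)) = \<pi>2"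
    by (rule kernel_representation[OF p2(2) trans[OF p2(1) sets_borel_prod_real]])
  define P where "P = \<pi>1 \<Otimes>\<^sub>M unif01"
  have [measurable_cong]: "sets P = sets ((borel \<Otimes>\<^sub>M borel) \<Otimes>\<^sub>M borel)"
    unfolding P_def
    by (intro sets_pair_measure_cong trans[OF p1(1) sets_borel_prod_real]) simp
  have prob_P: "prob_space P" unfolding P_def by (rule prob_space_pair) (unfold_locales)
  define X Y Z where "X w = fst (fst w)" and "Y w = snd (fst w)" and "Z w = g (Y w) (snd w)"
    for w :: "(real \<times> real) \<times> real"
  have [measurable]: "X \<in> borel_measurable P" "Y \<in> borel_measurable P"
    unfolding X_def Y_def by measurable
  have [measurable]: "Z \<in> borel_measurable P"
    unfolding Z_def Y_def by measurable
  have fst_P: "distr P \<pi>1 fst = \<pi>1"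
    unfolding P_def by (rule U.distr_pair_fst)
  have XY: "distr P borel (\<lambda>w. (X w, Y w)) = \<pi>1"
  proof -
    have "distr P borel (\<lambda>w. (X w, Y w)) = distr P \<pi>1 fst"
      unfolding X_def Y_def by (rule distr_cong) (auto simp: p1(1))
    then show ?thesis using fst_P by simp
  qed
  \<comment> \<open>The common marginal \<eta> is rewritten as the second marginal of \<pi>1, and
    \<open>unif01\<close> as an image under the identity, so that \<open>pair_measure_distr\<close>
    sees a product of two image measures.\<close>
  have "\<pi>2 = distr (distr \<pi>1 borel snd \<Otimes>\<^sub>M distr unif01 borel (\<lambda>u. u)) (borel \<Otimes>\<^sub>M borel) (\<lambda>(y, u). (y, g y u))"
    using g_eq by (simp add: p1(4) p2(3) distr_id2)
  also have "distr \<pi>1 borel snd \<Otimes>\<^sub>M distr unif01 borel (\<lambda>u. u) = distr P (borel \<Otimes>\<^sub>M borel) (\<lambda>(p, u). (snd p, u))"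
    unfolding P_def by (rule pair_measure_distr) (auto simp: distr_id2 U.sigma_finite_measure_axioms)
  also have "distr \<dots> (borel \<Otimes>\<^sub>M borel) (\<lambda>(y, u). (y, g y u)) = distr P borel (\<lambda>w. (Y w, Z w))"
    by (subst distr_distr) (auto simp: comp_def Y_def Z_def split_beta' borel_prod)
  finally have YZ: "distr P borel (\<lambda>w. (Y w, Z w)) = \<pi>2" by simp
  have "distr (distr P borel (\<lambda>w. (X w, Z w))) borel fst = distr P borel X"
    by (subst distr_distr) (auto simp: comp_def)
  also have "\<dots> = distr (distr P borel (\<lambda>w. (X w, Y w))) borel fst"
    by (subst distr_distr) (auto simp: comp_def)
  also have "\<dots> = \<rho>" unfolding XY by (rule p1(3))
  finally have 1: "distr (distr P borel (\<lambda>w. (X w, Z w))) borel fst = \<rho>" .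
  have "distr (distr P borel (\<lambda>w. (X w, Z w))) borel snd = distr P borel Z"
    by (subst distr_distr) (auto simp: comp_def)
  also have "\<dots> = distr (distr P borel (\<lambda>w. (Y w, Z w))) borel snd"
    by (subst distr_distr) (auto simp: comp_def)
  also have "\<dots> = \<zeta>" unfolding YZ by (rule p2(4))
  finally have 2: "distr (distr P borel (\<lambda>w. (X w, Z w))) borel snd = \<zeta>" .
  have "distr P borel (\<lambda>w. (X w, Z w)) \<in> couplings \<rho> \<zeta>"
    using 1 2 prob_space.prob_space_distr[OF prob_P, of "\<lambda>w. (X w, Z w)" borel] by (simp add: couplings_def)
  then show thesis by (intro that[OF prob_P _ _ _ XY YZ]) auto
qed

lemma D_fgw_triangle:
  assumes d1: "case_prod d1 \<in> borel_measurable (borel :: (real \<times> real) measure)"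
    and nonneg: "\<And>x y. 0 \<le> d1 x y"
    and tri: "\<And>x y z. d1 x z \<le> K * (d1 x y + d1 y z)" and K: "2 \<le> K"
  shows "D_fgw \<rho> \<zeta> \<beta> d1 \<le> ennreal K * (D_fgw \<rho> \<eta> \<beta> d1 + D_fgw \<eta> \<zeta> \<beta> d1)"
proof -
  have le: "D_fgw \<rho> \<zeta> \<beta> d1 \<le> ennreal K * (fgw_cost \<beta> d1 \<pi>1 + fgw_cost \<beta> d1 \<pi>2)"
    if \<pi>: "\<pi>1 \<in> couplings \<rho> \<eta>" "\<pi>2 \<in> couplings \<eta> \<zeta>" for \<pi>1 \<pi>2
  proof (rule couplings_glue[OF \<pi>])
    fix P :: "((real \<times> real) \<times> real) measure" and X Y Z
    assume P: "prob_space P"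
      "X \<in> borel_measurable P" "Y \<in> borel_measurable P" "Z \<in> borel_measurable P"
      "distr P borel (\<lambda>w. (X w, Y w)) = \<pi>1" "distr P borel (\<lambda>w. (Y w, Z w)) = \<pi>2"
      "distr P borel (\<lambda>w. (X w, Z w)) \<in> couplings \<rho> \<zeta>"
    have "D_fgw \<rho> \<zeta> \<beta> d1 \<le> fgw_cost \<beta> d1 (distr P borel (\<lambda>w. (X w, Z w)))"
      unfolding D_fgw_eq by (rule INF_lower) (rule P(7))
    also have "\<dots> \<le> ennreal K * (fgw_cost \<beta> d1 \<pi>1 + fgw_cost \<beta> d1 \<pi>2)"
      using fgw_cost_triangle[OF P(1-4) d1 nonneg tri K] unfolding P(5,6) .
    finally show ?thesis .
  qed
  define a b where "a = D_fgw \<rho> \<eta> \<beta> d1" and "b = D_fgw \<eta> \<zeta> \<beta> d1"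
  show ?thesis
    unfolding a_def[symmetric] b_def[symmetric]
  proof (rule ennreal_le_epsilon)
    fix e :: real assume fin: "ennreal K * (a + b) < top" and e: "0 < e"
    have ab: "a < top" "b < top"
      using fin K by (auto simp: ennreal_mult_less_top ennreal_eq_0_iff)
    \<comment> \<open>Near-optimal couplings replace minimisers. Two errors \<delta>, each
      multiplied by K, add up to e.\<close>
    define \<delta> where "\<delta> = e / (2 * K)"
    have \<delta>: "0 < \<delta>" using e K by (simp add: \<delta>_def)
    have "a < a + ennreal \<delta>" "b < b + ennreal \<delta>"
      using ab \<delta> by (cases a; cases b; simp add: ennreal_plus[symmetric] ennreal_less_iff del: ennreal_plus)+
    then obtain \<pi>1 \<pi>2 where \<pi>: "\<pi>1 \<in> couplings \<rho> \<eta>" "fgw_cost \<beta> d1 \<pi>1 < a + ennreal \<delta>"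
        "\<pi>2 \<in> couplings \<eta> \<zeta>" "fgw_cost \<beta> d1 \<pi>2 < b + ennreal \<delta>"
      by (metis (no_types, lifting) D_fgw_eq INF_less_iff a_def b_def)
    have "D_fgw \<rho> \<zeta> \<beta> d1 \<le> ennreal K * (fgw_cost \<beta> d1 \<pi>1 + fgw_cost \<beta> d1 \<pi>2)"
      using le \<pi> by blast
    also have "\<dots> \<le> ennreal K * ((a + ennreal \<delta>) + (b + ennreal \<delta>))"
      using \<pi> by (intro mult_left_mono add_mono) auto
    also have "\<dots> = ennreal K * (a + b) + ennreal K * (ennreal \<delta> + ennreal \<delta>)"
      by (simp add: distrib_left add_ac)
    also have "ennreal K * (ennreal \<delta> + ennreal \<delta>) = ennreal e"
      using \<delta> K by (simp add: ennreal_plus[symmetric] ennreal_mult'[symmetric] \<delta>_def del: ennreal_plus)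
    finally show "D_fgw \<rho> \<zeta> \<beta> d1 \<le> ennreal K * (a + b) + ennreal e" .
  qed
qed

text \<open>Swapping the coordinates of a coupling changes the linear term by the symmetry of
  \<open>d1\<close> and only the sign inside the square.\<close>

lemma D_fgw_sym:
  assumes d1: "case_prod d1 \<in> borel_measurable (borel :: (real \<times> real) measure)"
    and sym: "\<And>x y. d1 x y = d1 y x"
  shows "D_fgw \<rho> \<eta> \<beta> d1 = D_fgw \<eta> \<rho> \<beta> d1"
proof -
  have le: "D_fgw \<eta> \<rho> \<beta> d1 \<le> D_fgw \<rho> \<eta> \<beta> d1" for \<rho> \<eta>
    unfolding D_fgw_eq[of \<rho>]
  proof (rule INF_greatest)
    fix \<pi> assume "\<pi> \<in> couplings \<rho> \<eta>"
    then have p: "sets \<pi> = sets borel" "prob_space \<pi>" "distr \<pi> borel fst = \<rho>" "distr \<pi> borel snd = \<eta>"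
      by (auto simp: couplings_def)
    interpret \<pi>: prob_space \<pi> by fact
    note [measurable_cong] = sets_borel_prod_real p(1)
    have [measurable]: "fst \<in> borel_measurable \<pi>" "snd \<in> borel_measurable \<pi>" by measurable
    let ?\<pi> = "distr \<pi> borel (\<lambda>p. (snd p, fst p))"
    have "?\<pi> \<in> couplings \<eta> \<rho>"
      using p by (auto simp: couplings_def distr_distr comp_def \<pi>.prob_space_distr)
    then have "D_fgw \<eta> \<rho> \<beta> d1 \<le> fgw_cost \<beta> d1 ?\<pi>"
      unfolding D_fgw_eq by (rule INF_lower)
    also have "\<dots> = fgw_cost \<beta> d1 \<pi>"
      unfolding fgw_cost_def[of _ _ \<pi>]
      by (simp add: fgw_cost_distr[OF p(2) _ _ d1] sym[of "snd _" "fst _"] power2_commute[of "d1 (snd _) (snd _)"])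
    finally show "D_fgw \<eta> \<rho> \<beta> d1 \<le> fgw_cost \<beta> d1 \<pi>" .
  qed
  then show ?thesis by (intro antisym)
qed

section \<open>Measurability in the projection direction\<close>

text \<open>Restricting to rational half-lines makes equality of two laws a countable conjunction,
  hence a measurable condition when the laws depend on parameters.\<close>

lemma real_measure_eqI_rat:
  fixes M N :: "real measure"
  assumes sets: "sets M = sets borel" "sets N = sets borel" and "prob_space M" "prob_space N"
    and eq: "\<And>r. emeasure M {..real_of_rat r} = emeasure N {..real_of_rat r}"
  shows "M = N"
proof (rule measure_eqI_generator_eq_countable)
  interpret M: prob_space M by fact
  let ?E = "range (\<lambda>r. {..real_of_rat r})"
  have "sets (borel :: real measure) = sigma_sets UNIV ?E"
  proof (rule antisym)
    have "{..<x} \<in> sigma_sets UNIV ?E" for x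
    proof -
      have "{..<x} = (\<Union>r\<in>{r. real_of_rat r < x}. {..real_of_rat r})"
      proof (intro equalityI subsetI)
        fix z assume "z \<in> {..<x}"
        then obtain r where "z < real_of_rat r" "real_of_rat r < x" using of_rat_dense by auto
        then show "z \<in> (\<Union>r\<in>{r. real_of_rat r < x}. {..real_of_rat r})" by (auto intro: less_imp_le)
      qed auto
      also have "\<dots> \<in> sigma_sets UNIV ?E"
        by (intro sigma_sets_UNION) (auto intro: countable_subset)
      finally show ?thesis .
    qed
    then show "sets (borel :: real measure) \<subseteq> sigma_sets UNIV ?E"
      unfolding borel_Iio by (subst sets_measure_of) (auto intro!: sigma_sets_mono)
    show "sigma_sets UNIV ?E \<subseteq> sets (borel :: real measure)"
      by (rule sets.sigma_sets_subset[of _ borel, simplified]) auto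
  qed
  with sets show "sets M = sigma_sets UNIV ?E" "sets N = sigma_sets UNIV ?E" by simp_all
  show "Int_stable ?E"
  proof (rule Int_stableI)
    fix a b assume "a \<in> ?E" "b \<in> ?E"
    then obtain r s where "a = {..real_of_rat r}" "b = {..real_of_rat s}" by blast
    then have "a \<inter> b = {..real_of_rat (min r s)}"
      by (auto simp: min_def of_rat_less_eq intro: order_trans)
    then show "a \<inter> b \<in> ?E" by blast
  qed
  show "\<Union>?E = UNIV"
  proof (intro equalityI subsetI)
    fix z :: real
    obtain r where "z < real_of_rat r" using of_rat_dense[of z "z + 1"] by auto
    then show "z \<in> \<Union>?E" by (auto intro: less_imp_le)
  qed simp
  show "emeasure M a \<noteq> \<infinity>" for a by simp
qed (use eq in auto)

lemma D_fgw_proj_push_measurable: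
  fixes M :: "(real ^ 'n) measure" and \<mu> \<nu> :: "(real ^ 'n) measure"
  assumes "finite_measure M" and sets_M: "sets M = sets borel"
    and \<mu>: "sets \<mu> = sets borel" "prob_space \<mu>" and \<nu>: "sets \<nu> = sets borel" "prob_space \<nu>"
    and d1: "case_prod d1 \<in> borel_measurable (borel :: (real \<times> real) measure)"
  shows "(\<lambda>\<theta>. D_fgw (proj_push \<theta> \<mu>) (proj_push \<theta> \<nu>) \<beta> d1) \<in> borel_measurable (completion M)"
proof -
  interpret finite_measure M by fact
  interpret \<mu>: prob_space \<mu> by fact
  interpret \<nu>: prob_space \<nu> by fact
  interpret U: prob_space unif01 by (rule prob_space_unif01)
  note [measurable_cong] = sets_M \<mu>(1) \<nu>(1) sets_borel_prod_real
  note d1_measurable[measurable] = measurable_curried[OF d1]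
  \<comment> \<open>This measure does not depend on \<theta>, and both the marginal constraint and
    the cost become integrals over fixed measures.\<close>
  define P where "P = \<mu> \<Otimes>\<^sub>M unif01"
  have prob_P: "prob_space P" unfolding P_def by (rule prob_space_pair) unfold_locales
  interpret P: prob_space P by fact
  have sets_P[measurable_cong]: "sets P = sets (borel \<Otimes>\<^sub>M borel)"
    unfolding P_def using \<mu>(1) by (intro sets_pair_measure_cong) simp_all
  then have sets_P': "sets P = sets borel" unfolding borel_prod .
  obtain h :: "(nat \<Rightarrow> nat) \<Rightarrow> (real ^ 'n) \<times> real \<Rightarrow> real" where
    h': "(\<lambda>(y, w). h y w) \<in> borel_measurable (baire \<Otimes>\<^sub>M borel)" and
    h_ex: "\<And>P f. finite_measure P \<Longrightarrow> sets P = sets borel \<Longrightarrow> f \<in> borel_measurable borel \<Longrightarrow>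
       \<exists>y. AE w in P. h y w = f w"
    by (rule universal_measurable_function) blast
  have h[measurable]: "(\<lambda>(y, w). h y w) \<in> borel_measurable (baire \<Otimes>\<^sub>M (borel \<Otimes>\<^sub>M borel))"
    using h' unfolding borel_prod .
  have h_y[measurable]: "h y \<in> borel_measurable P" for y
    using measurable_Pair2[OF h, of y] unfolding measurable_cong_sets[OF sets_P refl] by (simp add: space_PiM)
  define law where "law \<theta> y = distr P borel (\<lambda>w. (\<theta> \<bullet> fst w, h y w))" for \<theta> y
  define F where "F \<theta> y = ennreal (1 - \<beta>) * (\<integral>\<^sup>+ w. ennreal (d1 (\<theta> \<bullet> fst w) (h y w)) \<partial>P)
   + ennreal \<beta> * (\<integral>\<^sup>+ w. (\<integral>\<^sup>+ v. ennreal ((d1 (\<theta> \<bullet> fst w) (\<theta> \<bullet> fst v) - d1 (h y w) (h y v))\<^sup>2) \<partial>P) \<partial>P)"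
    for \<theta> y
  have F_law: "fgw_cost \<beta> d1 (law \<theta> y) = F \<theta> y" for \<theta> y
    unfolding law_def F_def by (rule fgw_cost_distr[OF prob_P _ _ d1]) measurable
  \<comment> \<open>Only the second marginal has to be imposed; the first is \<theta>\<sharp>\<mu>
    for every code y.\<close>
  define L where "L \<theta> y \<longleftrightarrow> (\<forall>r. (\<integral>\<^sup>+ w. indicator {..real_of_rat r} (h y w) \<partial>P) =
      (\<integral>\<^sup>+ x. indicator {..real_of_rat r} (\<theta> \<bullet> x) \<partial>\<nu>))" for \<theta> y
  have L_iff: "L \<theta> y \<longleftrightarrow> distr P borel (h y) = proj_push \<theta> \<nu>" for \<theta> y
  proof -
    have 1: "(\<integral>\<^sup>+ w. indicator {..real_of_rat r} (h y w) \<partial>P) = emeasure (distr P borel (h y)) {..real_of_rat r}" for r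
      by (subst nn_integral_indicator[symmetric], simp, subst nn_integral_distr) auto
    have 2: "(\<integral>\<^sup>+ x. indicator {..real_of_rat r} (\<theta> \<bullet> x) \<partial>\<nu>) = emeasure (proj_push \<theta> \<nu>) {..real_of_rat r}" for r
      unfolding proj_push_def by (subst nn_integral_indicator[symmetric], simp, subst nn_integral_distr) auto
    show ?thesis
      unfolding L_def 1 2
    proof
      assume "\<forall>r. emeasure (distr P borel (h y)) {..real_of_rat r} = emeasure (proj_push \<theta> \<nu>) {..real_of_rat r}"
      then show "distr P borel (h y) = proj_push \<theta> \<nu>"
        by (intro real_measure_eqI_rat) (auto simp: proj_push_def P.prob_space_distr \<nu>.prob_space_distr)
    qed simp
  qed
  have fst_P: "distr P borel (\<lambda>w. \<theta> \<bullet> fst w) = proj_push \<theta> \<mu>" for \<theta>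
  proof -
    have "proj_push \<theta> \<mu> = distr (distr P \<mu> fst) borel (\<lambda>x. \<theta> \<bullet> x)"
      unfolding proj_push_def P_def by (subst U.distr_pair_fst) simp
    also have "\<dots> = distr P borel (\<lambda>w. \<theta> \<bullet> fst w)"
      unfolding P_def by (subst distr_distr) (auto simp: comp_def)
    finally show ?thesis by simp
  qed
  have law_fst: "distr (law \<theta> y) borel fst = proj_push \<theta> \<mu>" for \<theta> y
    unfolding law_def fst_P[symmetric] by (subst distr_distr) (auto simp: comp_def)
  have law_snd: "distr (law \<theta> y) borel snd = distr P borel (h y)" for \<theta> y
    unfolding law_def by (subst distr_distr) (auto simp: comp_def)
  have law_coupling: "law \<theta> y \<in> couplings (proj_push \<theta> \<mu>) (proj_push \<theta> \<nu>)" if "L \<theta> y" for \<theta> y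
    using that law_fst law_snd P.prob_space_distr[of "\<lambda>w. (\<theta> \<bullet> fst w, h y w)" borel]
    by (simp add: couplings_def L_iff law_def)
  have law_ex: "\<exists>y. law \<theta> y = \<pi>" if \<pi>: "\<pi> \<in> couplings (proj_push \<theta> \<mu>) (proj_push \<theta> \<nu>)" for \<theta> \<pi>
  proof -
    have p: "sets \<pi> = sets borel" "prob_space \<pi>" "distr \<pi> borel fst = proj_push \<theta> \<mu>"
      using \<pi> by (auto simp: couplings_def)
    obtain g :: "real \<Rightarrow> real \<Rightarrow> real" where
      g[measurable]: "(\<lambda>(y, u). g y u) \<in> borel_measurable (borel \<Otimes>\<^sub>M borel)" and
      g_eq: "distr (distr \<pi> borel fst \<Otimes>\<^sub>M unif01) (borel \<Otimes>\<^sub>M borel) (\<lambda>(y, u). (y, g y u)) = \<pi>"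
      by (rule kernel_representation[OF p(2) trans[OF p(1) sets_borel_prod_real]])
    \<comment> \<open>The kernel is evaluated at \<open>\<theta> \<bullet> x\<close>, whose law is
      the first marginal of \<pi>, so the pair with f has law \<pi>.\<close>
    define f where "f w = g (\<theta> \<bullet> fst w) (snd w)" for w :: "(real ^ 'n) \<times> real"
    have f[measurable]: "f \<in> borel_measurable (borel \<Otimes>\<^sub>M borel)" unfolding f_def by measurable
    then have f': "f \<in> borel_measurable borel" unfolding borel_prod .
    obtain y where y: "AE w in P. h y w = f w"
      using h_ex[OF P.finite_measure_axioms sets_P' f'] by blast
    \<comment> \<open>Codes determine functions only up to null sets, which a law does not
      see.\<close>
    have "law \<theta> y = distr P borel (\<lambda>w. (\<theta> \<bullet> fst w, f w))"
      unfolding law_def using y by (intro distr_cong_AE) auto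
    also have "\<dots> = distr (distr P (borel \<Otimes>\<^sub>M borel) (\<lambda>(x, u). (\<theta> \<bullet> x, u))) (borel \<Otimes>\<^sub>M borel) (\<lambda>(y, u). (y, g y u))"
      by (subst distr_distr) (auto simp: comp_def f_def split_beta' borel_prod)
    also have "distr P (borel \<Otimes>\<^sub>M borel) (\<lambda>(x, u). (\<theta> \<bullet> x, u)) =
        distr \<mu> borel (\<lambda>x. \<theta> \<bullet> x) \<Otimes>\<^sub>M distr unif01 borel (\<lambda>u. u)"
      unfolding P_def
      by (rule pair_measure_distr[symmetric]) (auto simp: distr_id2 U.sigma_finite_measure_axioms)
    also have "\<dots> = distr \<pi> borel fst \<Otimes>\<^sub>M unif01"
      by (simp add: distr_id2 p(3) proj_push_def)
    also note g_eq
    finally show ?thesis by blast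
  qed
  show ?thesis
  proof (rule borel_measurableI_less)
    fix c :: ennreal
    define B where "B = {z \<in> space (M \<Otimes>\<^sub>M baire). L (fst z) (snd z) \<and> F (fst z) (snd z) < c}"
    have B: "B \<in> sets (M \<Otimes>\<^sub>M baire)"
      unfolding B_def L_def F_def by measurable
    \<comment> \<open>The strict inequality turns the infimum into an existential, whether or not it
      is attained.\<close>
    have "D_fgw (proj_push \<theta> \<mu>) (proj_push \<theta> \<nu>) \<beta> d1 < c \<longleftrightarrow> (\<exists>y. L \<theta> y \<and> F \<theta> y < c)" for \<theta>
    proof
      assume "D_fgw (proj_push \<theta> \<mu>) (proj_push \<theta> \<nu>) \<beta> d1 < c"
      then obtain \<pi> where \<pi>: "\<pi> \<in> couplings (proj_push \<theta> \<mu>) (proj_push \<theta> \<nu>)" "fgw_cost \<beta> d1 \<pi> < c"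
        unfolding D_fgw_eq INF_less_iff by blast
      then obtain y where y: "law \<theta> y = \<pi>" using law_ex by blast
      then have "L \<theta> y" using \<pi>(1) law_snd[of \<theta> y] by (simp add: couplings_def L_iff)
      moreover have "F \<theta> y < c" using \<pi>(2) y F_law by metis
      ultimately show "\<exists>y. L \<theta> y \<and> F \<theta> y < c" by blast
    next
      assume "\<exists>y. L \<theta> y \<and> F \<theta> y < c"
      then show "D_fgw (proj_push \<theta> \<mu>) (proj_push \<theta> \<nu>) \<beta> d1 < c"
        unfolding D_fgw_eq INF_less_iff using law_coupling F_law by metis
    qed
    then have "{\<theta> \<in> space (completion M). D_fgw (proj_push \<theta> \<mu>) (proj_push \<theta> \<nu>) \<beta> d1 < c} = fst ` B"
      unfolding B_def by (force simp: space_pair_measure space_PiM)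
    then show "{\<theta> \<in> space (completion M). D_fgw (proj_push \<theta> \<mu>) (proj_push \<theta> \<nu>) \<beta> d1 < c} \<in> sets (completion M)"
      using measurable_projection[OF B] by simp
  qed
qed

section \<open>The sliced discrepancy\<close>

lemma sets_sphere_surface [simp, measurable_cong]: "sets sphere_surface = sets borel"
  unfolding sphere_surface_def using sets.sigma_sets_eq[of borel] by (simp add: sets_measure_of_conv)

text \<open>\<open>emeasure_measure_of_conv\<close> leaves two possible values, the cone formula and
  0. The cone over the sphere lies in the unit ball, which bounds the first.\<close>

lemma finite_measure_sphere_surface: "finite_measure (sphere_surface :: (real ^ 'n) measure)"
proof (rule finite_measureI)
  let ?B = "{r *\<^sub>R x | r x. r \<in> {0..1} \<and> x \<in> UNIV \<inter> sphere 0 1} :: (real ^ 'n) set"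
  have "emeasure lborel ?B \<le> emeasure lborel (cball 0 1 :: (real ^ 'n) set)"
    by (rule emeasure_mono) (auto simp: mult_le_one)
  also have "\<dots> < \<infinity>" using emeasure_lborel_cball_finite by (simp add: less_top)
  finally have "ennreal (real CARD('n)) * emeasure lborel ?B < \<infinity>"
    by (simp add: ennreal_mult_less_top)
  moreover have "space (sphere_surface :: (real ^ 'n) measure) = UNIV"
    using sets_eq_imp_space_eq[OF sets_sphere_surface] by simp
  ultimately show "emeasure sphere_surface (space (sphere_surface :: (real ^ 'n) measure)) \<noteq> \<infinity>"
    unfolding sphere_surface_def by (simp add: emeasure_measure_of_conv space_measure_of_conv less_top)
qed

text \<open>All power spherical laws are densities over the surface measure, so its null sets are
  null for each of them and f can be chosen before \<epsilon>.\<close>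

lemma D_fgw_power_spherical_AE_eq:
  fixes \<mu> \<nu> :: "(real ^ 'n) measure"
  assumes "\<mu> \<in> prob_fin_moments" "\<nu> \<in> prob_fin_moments"
    and d1: "case_prod d1 \<in> borel_measurable (borel :: (real \<times> real) measure)"
  obtains f where "f \<in> borel_measurable borel"
    "\<And>\<epsilon>. AE \<theta> in power_spherical \<epsilon> \<kappa>. D_fgw (proj_push \<theta> \<mu>) (proj_push \<theta> \<nu>) \<beta> d1 = f \<theta>"
proof -
  have "(\<lambda>\<theta>. D_fgw (proj_push \<theta> \<mu>) (proj_push \<theta> \<nu>) \<beta> d1) \<in> borel_measurable (completion sphere_surface)"
    using assms by (intro D_fgw_proj_push_measurable finite_measure_sphere_surface) (auto simp: prob_fin_moments_def)
  from completion_ex_borel_measurable[OF this] obtain f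
    where f: "f \<in> borel_measurable sphere_surface"
      "AE \<theta> in sphere_surface. D_fgw (proj_push \<theta> \<mu>) (proj_push \<theta> \<nu>) \<beta> d1 = f \<theta>"
    by blast
  show thesis
  proof (rule that)
    show "f \<in> borel_measurable borel" using f(1) by simp
    show "AE \<theta> in power_spherical \<epsilon> \<kappa>. D_fgw (proj_push \<theta> \<mu>) (proj_push \<theta> \<nu>) \<beta> d1 = f \<theta>" for \<epsilon>
      unfolding power_spherical_def using f(2) by (subst AE_density) auto
  qed
qed

theorem theorem7:
  fixes \<beta> \<kappa> :: real and d1 :: "real \<Rightarrow> real \<Rightarrow> real"
  assumes "CARD('n) \<ge> 2"
    and "\<beta> \<in> {0..1}"
    and "\<kappa> > 0"
    and "pseudo_metric_real d1"
    and "case_prod d1 \<in> borel_measurable (borel :: (real \<times> real) measure)"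
  shows "(\<forall>\<mu>\<in>(prob_fin_moments :: (real ^ 'n) measure set). \<forall>\<nu>\<in>prob_fin_moments.
            0 \<le> PSSFG \<mu> \<nu> \<beta> \<kappa> d1 \<and> PSSFG \<mu> \<nu> \<beta> \<kappa> d1 = PSSFG \<nu> \<mu> \<beta> \<kappa> d1)
       \<and> (\<exists>C'>0. \<forall>\<mu>\<in>(prob_fin_moments :: (real ^ 'n) measure set).
            \<forall>\<nu>\<in>prob_fin_moments. \<forall>\<xi>\<in>prob_fin_moments.
              PSSFG \<mu> \<xi> \<beta> \<kappa> d1
                \<le> ennreal C' * (PSSFG \<mu> \<nu> \<beta> \<kappa> d1 + PSSFG \<nu> \<xi> \<beta> \<kappa> d1))"
proof -
  from assms(4) obtain C where nonneg: "\<And>x y. 0 \<le> d1 x y" and sym: "\<And>x y. d1 x y = d1 y x"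
    and C: "\<And>x y z. d1 x z \<le> C * (d1 x y + d1 y z)"
    unfolding pseudo_metric_real_def by blast
  note d1 = assms(5)
  define K where "K = max C 2"
  have tri: "d1 x z \<le> K * (d1 x y + d1 y z)" for x y z
    using C[of x z y] mult_right_mono[of C K "d1 x y + d1 y z"] nonneg
    by (auto simp: K_def intro: order_trans)
  have K: "2 \<le> K" by (simp add: K_def)
  have "PSSFG \<mu> \<xi> \<beta> \<kappa> d1 \<le> ennreal K * (PSSFG \<mu> \<nu> \<beta> \<kappa> d1 + PSSFG \<nu> \<xi> \<beta> \<kappa> d1)"
    if \<mu>: "\<mu> \<in> prob_fin_moments" and \<nu>: "\<nu> \<in> prob_fin_moments" and \<xi>: "\<xi> \<in> prob_fin_moments"
    for \<mu> \<nu> \<xi> :: "(real ^ 'n) measure"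
    unfolding PSSFG_def[of \<mu> \<xi>]
  proof (rule SUP_least)
    fix \<epsilon> :: "real ^ 'n" assume \<epsilon>: "\<epsilon> \<in> sphere 0 1"
    let ?PS = "power_spherical \<epsilon> \<kappa>"
    have [measurable_cong]: "sets ?PS = sets borel" by (simp add: power_spherical_def)
    let ?D = "\<lambda>\<mu> \<nu> \<theta>. D_fgw (proj_push \<theta> \<mu>) (proj_push \<theta> \<nu>) \<beta> d1"
    obtain f where f: "f \<in> borel_measurable borel" "AE \<theta> in ?PS. ?D \<mu> \<nu> \<theta> = f \<theta>"
      using D_fgw_power_spherical_AE_eq[OF \<mu> \<nu> d1] by blast
    obtain g where g: "g \<in> borel_measurable borel" "AE \<theta> in ?PS. ?D \<nu> \<xi> \<theta> = g \<theta>"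
      using D_fgw_power_spherical_AE_eq[OF \<nu> \<xi> d1] by blast
    note [measurable] = f(1) g(1)
    \<comment> \<open>Monotonicity holds for arbitrary integrands. Borel versions are substituted on
      the right only, to split the sum, and are exchanged back afterwards.\<close>
    have "(\<integral>\<^sup>+ \<theta>. ?D \<mu> \<xi> \<theta> \<partial>?PS) \<le> (\<integral>\<^sup>+ \<theta>. ennreal K * (?D \<mu> \<nu> \<theta> + ?D \<nu> \<xi> \<theta>) \<partial>?PS)"
      by (intro nn_integral_mono D_fgw_triangle[OF d1 nonneg tri K])
    also have "\<dots> = (\<integral>\<^sup>+ \<theta>. ennreal K * (f \<theta> + g \<theta>) \<partial>?PS)"
      using f(2) g(2) by (intro nn_integral_cong_AE) auto
    also have "\<dots> = ennreal K * ((\<integral>\<^sup>+ \<theta>. f \<theta> \<partial>?PS) + (\<integral>\<^sup>+ \<theta>. g \<theta> \<partial>?PS))"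
      by (simp add: nn_integral_cmult nn_integral_add)
    also have "(\<integral>\<^sup>+ \<theta>. f \<theta> \<partial>?PS) = (\<integral>\<^sup>+ \<theta>. ?D \<mu> \<nu> \<theta> \<partial>?PS)"
      using f(2) by (intro nn_integral_cong_AE) auto
    also have "\<dots> \<le> PSSFG \<mu> \<nu> \<beta> \<kappa> d1"
      unfolding PSSFG_def using \<epsilon> by (rule SUP_upper)
    also have "(\<integral>\<^sup>+ \<theta>. g \<theta> \<partial>?PS) = (\<integral>\<^sup>+ \<theta>. ?D \<nu> \<xi> \<theta> \<partial>?PS)"
      using g(2) by (intro nn_integral_cong_AE) auto
    also have "\<dots> \<le> PSSFG \<nu> \<xi> \<beta> \<kappa> d1"
      unfolding PSSFG_def using \<epsilon> by (rule SUP_upper)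
    finally show "(\<integral>\<^sup>+ \<theta>. ?D \<mu> \<xi> \<theta> \<partial>?PS) \<le> ennreal K * (PSSFG \<mu> \<nu> \<beta> \<kappa> d1 + PSSFG \<nu> \<xi> \<beta> \<kappa> d1)"
      by (simp add: add_mono mult_left_mono)
  qed
  moreover have "PSSFG \<mu> \<nu> \<beta> \<kappa> d1 = PSSFG \<nu> \<mu> \<beta> \<kappa> d1" for \<mu> \<nu> :: "(real ^ 'n) measure"
    unfolding PSSFG_def D_fgw_sym[OF d1 sym, of "proj_push _ \<mu>"] ..
  ultimately show ?thesis using K by (auto intro!: exI[of _ K])
qed

end
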